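(* Let $n\ge 2$, let $k\ge1$ be an integer with $2k\ge n$, let $f\in L^1(\mathbb{R}^n)$, and let $u$ be the harmonic (Poisson) extension of $f$ to $\mathbb{R}^{n+1}_+=\{(x,y):x\in\mathbb{R}^n,\ y>0\}$. For $\theta\in S_{n-1}$ and $\Im z>0$ set $$F_\theta(z)=\int_0^\infty e^{2i\pi r z}\,\hat f(r\theta)\,r^{n-1}\,dr .$$ Then, as an equality in $[0,+\infty]$, $$\iint_{\mathbb{R}^{n+1}_+}\left|\frac{\partial^k u(x,y)}{\partial y^k}\right|^2y^{2k-n}\,dx\,dy=\frac{(4\pi)^{n-1}\,\Gamma(2k-n+1)}{2^{2k}}\int_{S_{n-1}}\|F_\theta\|_{\mathsf{H}^2(\mathbb{R})}^2\,d\theta .$$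
   Context: The Fourier transform is $\hat f(\xi)=\int_{\mathbb{R}^n}f(x)e^{-2i\pi x\cdot\xi}\,dx$. $S_{n-1}$ is the unit sphere of $\mathbb{R}^n$ and $d\theta$ its (unnormalized) surface measure. The harmonic extension is $u(x,y)=(f\star\mathsf{P}_y)(x)=\int_{\mathbb{R}^n} e^{2i\pi x\cdot\xi}e^{-2\pi|\xi|y}\hat f(\xi)\,d\xi$, where $\mathsf{P}_y$ is the Poisson kernel. For $F$ analytic on the upper half plane, $\|F\|_{\mathsf{H}^2(\mathbb{R})}=\sup_{y>0}\|F(\cdot+iy)\|_{L^2(\mathbb{R})}\in[0,+\infty]$. *)

theory Defs
  imports "HOL-Analysis.Analysis"
begin

definition fourier :: "(real^'n \<Rightarrow> complex) \<Rightarrow> real^'n \<Rightarrow> complex" where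
  "fourier f \<xi> = (LINT x|lebesgue. f x * exp (- 2 * \<i> * of_real pi * of_real (x \<bullet> \<xi>)))"

(* Normalised so that P_y has integral 1 and Fourier transform exp (- 2 * pi * norm \<xi> * y). *)
definition poisson_kernel :: "real \<Rightarrow> real^'n \<Rightarrow> real" where
  "poisson_kernel y x =
     Gamma ((real CARD('n) + 1) / 2) / pi powr ((real CARD('n) + 1) / 2)
       * (y / ((norm x)\<^sup>2 + y\<^sup>2) powr ((real CARD('n) + 1) / 2))"

(* Only the values at y > 0 are meaningful. *)
definition harmonic_ext :: "(real^'n \<Rightarrow> complex) \<Rightarrow> real^'n \<Rightarrow> real \<Rightarrow> complex" where
  "harmonic_ext f x y = (LINT t|lebesgue. f t * of_real (poisson_kernel y (x - t)))"

(* k-th derivative of a complex-valued function of one real variable. *)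
definition nth_vector_derivative :: "nat \<Rightarrow> (real \<Rightarrow> complex) \<Rightarrow> real \<Rightarrow> complex" where
  "nth_vector_derivative k g = ((\<lambda>h t. vector_derivative h (at t)) ^^ k) g"

(* Unnormalised surface measure on the unit sphere, as the cone measure:
   a Borel set A of unit vectors has measure DIM * vol {x. 0 < norm x < 1, x / norm x \<in> A}.
   See emeasure_sphere_measure below; sgn x is x / norm x. *)
definition sphere_measure :: "'a::euclidean_space measure" where
  "sphere_measure =
     scale_measure (of_nat DIM('a))
       (distr (restrict_space lborel (ball 0 1 - {0})) (restrict_space borel (sphere 0 1)) sgn)"

lemma sgn_measurable_sphere:
  "sgn \<in> measurable (restrict_space lborel (ball 0 1 - {0}))
          (restrict_space borel (sphere 0 1 :: 'a::euclidean_space set))"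
proof (rule measurable_restrict_space2)
  show "sgn \<in> space (restrict_space lborel (ball 0 1 - {0})) \<rightarrow> (sphere 0 1 :: 'a set)"
    by (auto simp: space_restrict_space norm_sgn)
  have "(\<lambda>x::'a. x /\<^sub>R norm x) \<in> borel_measurable borel"
    by measurable
  then have "(sgn :: 'a \<Rightarrow> 'a) \<in> borel_measurable lborel"
    by (simp add: sgn_div_norm[abs_def])
  then show "sgn \<in> measurable (restrict_space lborel (ball 0 1 - {0})) (borel :: 'a measure)"
    by (rule measurable_restrict_space1)
qed

lemma emeasure_sphere_measure:
  fixes A :: "'a::euclidean_space set"
  assumes "A \<in> sets borel" "A \<subseteq> sphere 0 1"
  shows "emeasure sphere_measure A
    = of_nat DIM('a) * emeasure lborel {x \<in> ball 0 1 - {0}. x /\<^sub>R norm x \<in> A}"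
proof -
  have A: "A \<in> sets (restrict_space borel (sphere 0 1))"
    using assms by (simp add: sets_restrict_space_iff)
  have "sgn -` A \<inter> (ball 0 1 - {0}) = {x \<in> ball 0 1 - {0}. x /\<^sub>R norm x \<in> A}"
    by (auto simp: sgn_div_norm)
  moreover have "emeasure (restrict_space lborel (ball 0 1 - {0})) B = emeasure lborel B"
    if "B \<subseteq> ball 0 1 - {0}" for B :: "'a set"
    using that by (intro emeasure_restrict_space) auto
  ultimately show ?thesis
    using A by (simp add: sphere_measure_def emeasure_distr sgn_measurable_sphere
        space_restrict_space subset_iff)
qed

definition F_theta :: "(real^'n \<Rightarrow> complex) \<Rightarrow> real^'n \<Rightarrow> complex \<Rightarrow> complex" where
  "F_theta f \<theta> z =
     (LINT r:{0<..}|lborel.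
        exp (2 * \<i> * of_real pi * of_real r * z) * fourier f (r *\<^sub>R \<theta>) * of_real (r ^ (CARD('n) - 1)))"

(* The square root on [0, \<infinity>]. *)
definition ennsqrt :: "ennreal \<Rightarrow> ennreal" where
  "ennsqrt a = (if a = \<infinity> then \<infinity> else ennreal (sqrt (enn2real a)))"

definition L2_norm :: "(real \<Rightarrow> complex) \<Rightarrow> ennreal" where
  "L2_norm g = ennsqrt (\<integral>\<^sup>+x. ennreal ((cmod (g x))\<^sup>2) \<partial>lborel)"

definition H2_norm :: "(complex \<Rightarrow> complex) \<Rightarrow> ennreal" where
  "H2_norm F = (SUP y\<in>{0<..}. L2_norm (\<lambda>x. F (Complex x y)))"

end

theory Submission
  imports Defs "HOL-Probability.Probability" "HOL-Real_Asymp.Real_Asymp"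
begin

text \<open>Writing the Poisson extension as an integral over frequencies, $\partial_y^k u(\cdot, y)$ is the inverse
  Fourier transform of $(-2\pi|\xi|)^k e^{-2\pi|\xi|y} \hat f(\xi)$. Plancherel in $x$ and a Gamma integral in $y$
  turn the left-hand side into a multiple of $\int |\xi|^{n-1} |\hat f(\xi)|^2 d\xi$.
  One-dimensional Plancherel gives
  $\|F_\theta(\cdot + iy)\|^2 = \int_0^\infty e^{-4\pi r y} |\hat f(r\theta)|^2 r^{2n-2} dr$, whose supremum over $y$ is the
  value at $y = 0$, so polar coordinates turn the right-hand side into the same integral. Plancherel is only
  needed for continuous bounded integrable functions, where Gaussian damping suffices.\<close>

section \<open>Gaussians\<close>

text \<open>An integrable \<open>f\<close> need not be square integrable, so both sides may be
  infinite. The identity is therefore carried through nonnegative integrals and Tonelli, with no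
  finiteness claim. Plancherel is invoked only at a height \<open>y > 0\<close>, where the
  exponential weight times a power of the frequency makes the bounded continuous function
  \<open>fourier f\<close> integrable while keeping it bounded; the height \<open>y = 0\<close> is
  reached by monotone convergence. Since \<open>harmonic_ext\<close> is a convolution with an
  explicit kernel, its frequency form has to be derived:
  \<open>exp (- 2 * pi * y * norm \<xi>)\<close> is a superposition of Gaussians in \<xi>, and
  transforming these produces the kernel together with its Gamma constant. The powers of the
  frequency balance as follows: \<open>2 * k\<close> from the derivatives minus
  \<open>2 * k - n + 1\<close> from the Gamma integral is \<open>n - 1\<close>, and squaring
  \<open>r ^ (n - 1)\<close> in \<open>F_theta\<close> also leaves \<open>n - 1\<close> once the
  polar Jacobian has taken its share.\<close>

lemma nn_integral_lborel_affine:
  fixes f :: "'a::euclidean_space \<Rightarrow> ennreal" and c :: real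
  assumes [measurable]: "f \<in> borel_measurable borel" and c: "c \<noteq> 0"
  shows "(\<integral>\<^sup>+x. f x \<partial>lborel) = ennreal (\<bar>c\<bar> ^ DIM('a)) * (\<integral>\<^sup>+x. f (t + c *\<^sub>R x) \<partial>lborel)"
  by (subst lborel_affine[OF c, of t])
     (simp add: nn_integral_density nn_integral_distr nn_integral_cmult)

lemma lborel_integrable_affine:
  fixes f :: "'a::euclidean_space \<Rightarrow> 'b::{banach, second_countable_topology}"
  assumes f: "integrable lborel f" and c: "c \<noteq> 0"
  shows "integrable lborel (\<lambda>x. f (t + c *\<^sub>R x))"
  using f f[THEN borel_measurable_integrable] unfolding integrable_iff_bounded
  by (subst (asm) nn_integral_lborel_affine[where c=c and t=t]) (auto simp: ennreal_mult_less_top c)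

lemma lborel_integral_affine:
  fixes f :: "'a::euclidean_space \<Rightarrow> 'b::{banach, second_countable_topology}" and c :: real
  assumes c: "c \<noteq> 0" and f: "integrable lborel f"
  shows "(\<integral>x. f x \<partial>lborel) = \<bar>c\<bar> ^ DIM('a) *\<^sub>R (\<integral>x. f (t + c *\<^sub>R x) \<partial>lborel)"
  using c f f[THEN borel_measurable_integrable] lborel_integrable_affine[OF f c, of t]
  by (subst lborel_affine[OF c, of t]) (simp add: integral_density integral_distr)

lemma borel_measurable_cis [measurable]: "cis \<in> borel_measurable borel"
  by (intro borel_measurable_continuous_onI continuous_intros)

text \<open>A dilation reduces this to the known characteristic function
  \<open>exp (- u\<^sup>2 / 2)\<close> of the standard normal distribution.\<close>

lemma gaussian_fourier_real:
  fixes s x :: real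
  assumes "s > 0"
  shows "integrable lborel (\<lambda>t. complex_of_real (exp (- pi * s\<^sup>2 * t\<^sup>2)) * cis (2 * pi * (x * t)))"
    and "(LINT t|lborel. complex_of_real (exp (- pi * s\<^sup>2 * t\<^sup>2)) * cis (2 * pi * (x * t)))
      = of_real (1 / s * exp (- pi * x\<^sup>2 / s\<^sup>2))"
proof -
  \<comment> \<open>The dilation by \<open>a\<close> turns the exponent
    \<open>- (a * t)\<^sup>2 / 2\<close> into \<open>- pi * s\<^sup>2 * t\<^sup>2\<close>; the
    frequency \<open>u\<close> below is chosen so that
    \<open>u * (a * t) = 2 * pi * x * t\<close>.\<close>
  define a where "a = sqrt (2 * pi) * s"
  have a: "a > 0" "a\<^sup>2 = 2 * pi * s\<^sup>2" using assms by (auto simp: a_def power_mult_distrib)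
  define u where "u = 2 * pi * x / a"
  define G where "G = (\<lambda>t. of_real (std_normal_density t) * cis (u * t))"
  have G[measurable]: "G \<in> borel_measurable borel" unfolding G_def by measurable
  have int: "integrable lborel G"
  proof (rule Bochner_Integration.integrable_bound[of _ std_normal_density])
    show "integrable lborel std_normal_density" using integrable_std_normal_moment[of 0] by simp
  qed (auto simp: G_def norm_mult)
  have "integral\<^sup>L lborel G = char std_normal_distribution u"
    unfolding char_def G_def
    by (subst integral_density) (auto simp: scaleR_conv_of_real cis_conv_exp normal_density_nonneg)
  then have val: "integral\<^sup>L lborel G = of_real (exp (- u\<^sup>2 / 2))"
    by (simp add: char_std_normal_distribution)
  have eq: "G (0 + a * t) = of_real (1 / sqrt (2 * pi)) *
      (complex_of_real (exp (- pi * s\<^sup>2 * t\<^sup>2)) * cis (2 * pi * (x * t)))" for t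
    using a by (simp add: G_def std_normal_density_def u_def power_mult_distrib mult_ac)
  have "integrable lborel (\<lambda>t. G (0 + a * t))"
    using a int by (intro lborel_integrable_real_affine) auto
  then show "integrable lborel (\<lambda>t. complex_of_real (exp (- pi * s\<^sup>2 * t\<^sup>2)) * cis (2 * pi * (x * t)))"
    using integrable_mult_right[of "of_real (sqrt (2 * pi))" lborel "\<lambda>t. G (0 + a * t)"]
    unfolding eq by (simp only: mult.assoc[symmetric] of_real_mult[symmetric]) simp
  have "integral\<^sup>L lborel G = a *\<^sub>R (of_real (1 / sqrt (2 * pi)) *
    (LINT t|lborel. complex_of_real (exp (- pi * s\<^sup>2 * t\<^sup>2)) * cis (2 * pi * (x * t))))"
    using a by (subst lborel_integral_real_affine[of a _ 0]) (auto simp only: eq integral_mult_right_zero abs_of_pos)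
  also have "\<dots> = of_real s * (LINT t|lborel. complex_of_real (exp (- pi * s\<^sup>2 * t\<^sup>2)) * cis (2 * pi * (x * t)))"
    by (simp add: scaleR_conv_of_real a_def)
  finally have "of_real s * (LINT t|lborel. complex_of_real (exp (- pi * s\<^sup>2 * t\<^sup>2)) * cis (2 * pi * (x * t)))
     = of_real (exp (- u\<^sup>2 / 2))" using val by simp
  moreover have "u\<^sup>2 / 2 = pi * x\<^sup>2 / s\<^sup>2"
    using a assms by (simp add: u_def power_divide power_mult_distrib a(2) field_simps power2_eq_square)
  ultimately show "(LINT t|lborel. complex_of_real (exp (- pi * s\<^sup>2 * t\<^sup>2)) * cis (2 * pi * (x * t)))
      = of_real (1 / s * exp (- pi * x\<^sup>2 / s\<^sup>2))"
    using assms by (simp add: field_simps)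
qed

lemma cis_sum: "finite A \<Longrightarrow> cis (\<Sum>i\<in>A. g i) = (\<Prod>i\<in>A. cis (g i))"
  by (induction A rule: finite_induct) (auto simp: cis_mult [symmetric])

text \<open>Squared norm and inner product are sums over \<open>Basis\<close>, so the integrand is a
  product of one-variable Gaussians, and \<open>lborel\<close> is the image of the product measure
  over \<open>Basis\<close>.\<close>

lemma gaussian_fourier:
  fixes x :: "'a::euclidean_space"
  assumes "s > 0"
  shows "integrable lborel (\<lambda>t. complex_of_real (exp (- pi * s\<^sup>2 * (norm t)\<^sup>2)) * cis (2 * pi * (x \<bullet> t)))"
    and "(LINT t|lborel. complex_of_real (exp (- pi * s\<^sup>2 * (norm t)\<^sup>2)) * cis (2 * pi * (x \<bullet> t)))
      = of_real ((1 / s) ^ DIM('a) * exp (- pi * (norm x)\<^sup>2 / s\<^sup>2))"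
proof -
  interpret product_sigma_finite "\<lambda>_::'a. lborel :: real measure" ..
  define g where "g = (\<lambda>(b::'a) (t::real). complex_of_real (exp (- pi * s\<^sup>2 * t\<^sup>2)) * cis (2 * pi * ((x \<bullet> b) * t)))"
  define F where "F = (\<lambda>t::'a. complex_of_real (exp (- pi * s\<^sup>2 * (norm t)\<^sup>2)) * cis (2 * pi * (x \<bullet> t)))"
  have [measurable]: "F \<in> borel_measurable borel" unfolding F_def by measurable
  have norm2: "(norm t)\<^sup>2 = (\<Sum>b\<in>Basis. (t \<bullet> b)\<^sup>2)" for t :: 'a
    unfolding power2_norm_eq_inner by (subst euclidean_inner) (simp add: power2_eq_square)
  have expo: "- pi * s\<^sup>2 * (norm t)\<^sup>2 = (\<Sum>b\<in>Basis. - pi * s\<^sup>2 * (t \<bullet> b)\<^sup>2)" for t :: 'a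
    by (simp add: norm2 sum_distrib_left)
  have ang: "2 * pi * (x \<bullet> t) = (\<Sum>b\<in>Basis. 2 * pi * ((x \<bullet> b) * (t \<bullet> b)))" for t :: 'a
    by (subst euclidean_inner) (simp add: sum_distrib_left)
  have F: "F t = (\<Prod>b\<in>Basis. g b (t \<bullet> b))" for t
    unfolding F_def g_def expo ang by (simp only: exp_sum finite_Basis of_real_prod cis_sum prod.distrib)
  have sumB: "(\<Sum>b\<in>Basis. f b *\<^sub>R b) \<bullet> i = f i" if "i \<in> Basis" for f and i :: 'a
    using that by (simp add: inner_sum_left inner_Basis if_distrib cong: if_cong)
  have Fp: "F (\<Sum>b\<in>Basis. f b *\<^sub>R b) = (\<Prod>b\<in>Basis. g b (f b))" for f
    unfolding F by (rule prod.cong) (auto simp: sumB)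
  have ig: "integrable lborel (g b)" for b
    unfolding g_def by (rule gaussian_fourier_real(1)[OF assms])
  have vg: "integral\<^sup>L lborel (g b) = of_real (1 / s * exp (- pi * (x \<bullet> b)\<^sup>2 / s\<^sup>2))" for b
    unfolding g_def by (rule gaussian_fourier_real(2)[OF assms])
  have ip: "integrable (\<Pi>\<^sub>M b\<in>Basis. lborel) (\<lambda>f. \<Prod>b\<in>Basis. g b (f b))"
    by (rule product_integrable_prod) (auto intro: ig)
  have "integrable lborel F"
    unfolding lborel_eq[where 'a='a]
    by (subst integrable_distr_eq) (auto simp: Fp ip)
  moreover have "integral\<^sup>L lborel F = (\<Prod>b\<in>Basis. integral\<^sup>L lborel (g b))"
    unfolding lborel_eq[where 'a='a]
    by (subst integral_distr) (auto simp: Fp product_integral_prod ig)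
  moreover have "(\<Prod>b\<in>Basis. integral\<^sup>L lborel (g b)) = of_real ((1 / s) ^ DIM('a) * exp (- pi * (norm x)\<^sup>2 / s\<^sup>2))"
    by (simp add: vg norm2 exp_sum[symmetric] sum_distrib_left sum_negf sum_divide_distrib prod_dividef power_divide flip: of_real_prod)
  ultimately show "integrable lborel (\<lambda>t. complex_of_real (exp (- pi * s\<^sup>2 * (norm t)\<^sup>2)) * cis (2 * pi * (x \<bullet> t)))"
    and "(LINT t|lborel. complex_of_real (exp (- pi * s\<^sup>2 * (norm t)\<^sup>2)) * cis (2 * pi * (x \<bullet> t)))
      = of_real ((1 / s) ^ DIM('a) * exp (- pi * (norm x)\<^sup>2 / s\<^sup>2))"
    unfolding F_def by simp_all
qed

section \<open>Plancherel\<close>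

lemma borel_measurable_cnj [measurable (raw)]:
  "f \<in> borel_measurable M \<Longrightarrow> (\<lambda>x. cnj (f x)) \<in> borel_measurable M"
  by (rule borel_measurable_continuous_on[where f=cnj]) (auto intro: continuous_intros)

text \<open>This is the transform at frequency 0. At \<open>s = 1\<close> the mass is one, which
  makes the dilates of this Gaussian an approximate identity.\<close>

lemma integral_gaussian:
  assumes "s > 0"
  shows "integrable lborel (\<lambda>t::'a::euclidean_space. exp (- pi * s\<^sup>2 * (norm t)\<^sup>2))"
    and "(LINT t|lborel. exp (- pi * s\<^sup>2 * (norm (t::'a))\<^sup>2)) = (1 / s) ^ DIM('a)"
proof -
  have i: "integrable lborel (\<lambda>t::'a. complex_of_real (exp (- pi * s\<^sup>2 * (norm t)\<^sup>2)))"
    using gaussian_fourier(1)[OF assms, of "0::'a"] by simp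
  then show "integrable lborel (\<lambda>t::'a. exp (- pi * s\<^sup>2 * (norm t)\<^sup>2))"
    by (simp only: complex_of_real_integrable_eq)
  have "(LINT t|lborel. complex_of_real (exp (- pi * s\<^sup>2 * (norm (t::'a))\<^sup>2))) = of_real ((1 / s) ^ DIM('a))"
    using gaussian_fourier(2)[OF assms, of "0::'a"] by simp
  then show "(LINT t|lborel. exp (- pi * s\<^sup>2 * (norm (t::'a))\<^sup>2)) = (1 / s) ^ DIM('a)"
    by (simp only: integral_complex_of_real of_real_eq_iff)
qed

text \<open>Any Euclidean space is allowed because two instances occur: frequency space for the
  Poisson extension, and the real line for \<open>F_theta\<close> on a horizontal line. The forward
  transform is obtained by reflecting the argument.\<close>

definition inverse_fourier :: "('a::euclidean_space \<Rightarrow> complex) \<Rightarrow> 'a \<Rightarrow> complex" where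
  "inverse_fourier h x = (LINT \<xi>|lborel. h \<xi> * cis (2 * pi * (x \<bullet> \<xi>)))"

lemma borel_measurable_inverse_fourier [measurable]:
  assumes [measurable]: "h \<in> borel_measurable borel"
  shows "inverse_fourier h \<in> borel_measurable borel"
  unfolding inverse_fourier_def by measurable

lemma norm_inverse_fourier_le:
  "cmod (inverse_fourier h x) \<le> (LINT \<xi>|lborel. cmod (h \<xi>))"
  unfolding inverse_fourier_def
  by (rule order_trans[OF integral_norm_bound]) (simp add: norm_mult)

section \<open>Exchanging absolutely convergent integrals\<close>

lemma integrable_lborel_pair_mult:
  fixes g :: "'a::euclidean_space \<Rightarrow> real" and h :: "'b::euclidean_space \<Rightarrow> real"
  assumes "integrable lborel g" "integrable lborel h"
  shows "integrable (lborel \<Otimes>\<^sub>M lborel) (\<lambda>(x, y). g x * h y)"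
  using assms by (intro lborel_pair.Fubini_integrable) (auto simp: abs_mult)

text \<open>In the Gaussian and Poisson computations one variable is controlled by an integrable
  weight and the other by the modulus of the given integrable function, so a product majorant
  suffices.\<close>

lemma lborel_integral_swap:
  fixes F :: "'a::euclidean_space \<Rightarrow> 'b::euclidean_space \<Rightarrow> complex"
  assumes [measurable]: "case_prod F \<in> borel_measurable (borel \<Otimes>\<^sub>M borel)"
    and "integrable lborel g" "integrable lborel h"
    and "\<And>x y. cmod (F x y) \<le> g x * h y"
  shows "(LINT x|lborel. LINT y|lborel. F x y) = (LINT y|lborel. LINT x|lborel. F x y)"
proof (rule lborel_pair.Fubini_integral[symmetric])
  show "integrable (lborel \<Otimes>\<^sub>M lborel) (case_prod F)"
  proof (rule Bochner_Integration.integrable_bound[OF integrable_lborel_pair_mult[OF assms(2,3)]])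
    show "case_prod F \<in> borel_measurable (lborel \<Otimes>\<^sub>M lborel)" by measurable
    show "AE p in lborel \<Otimes>\<^sub>M lborel. norm (case_prod F p) \<le> norm (case p of (x, y) \<Rightarrow> g x * h y)"
      by (intro always_eventually) (auto intro: order_trans[OF assms(4) abs_ge_self])
  qed
qed

text \<open>Damping by a Gaussian makes the triple integral absolutely convergent and becomes an
  approximate identity in frequency.\<close>
lemma inverse_fourier_gaussian_norm:
  fixes h :: "'a::euclidean_space \<Rightarrow> complex"
  assumes h: "integrable lborel h" and s: "s > 0"
  shows "(LINT x|lborel. complex_of_real (exp (- pi * s\<^sup>2 * (norm x)\<^sup>2) * (cmod (inverse_fourier h x))\<^sup>2))
    = (LINT \<xi>|lborel. h \<xi> * (LINT w|lborel. cnj (h (\<xi> - s *\<^sub>R w)) * exp (- pi * (norm w)\<^sup>2)))"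
proof -
  let ?g = "\<lambda>x::'a. exp (- pi * s\<^sup>2 * (norm x)\<^sup>2)"
  let ?H = "inverse_fourier h"
  have [measurable]: "h \<in> borel_measurable borel" using h by auto
  have g: "integrable lborel ?g" by (rule integral_gaussian(1)[OF s])
  have habs: "integrable lborel (\<lambda>x. cmod (h x))" using h by auto
  have cnjH: "cnj (?H x) = (LINT \<eta>|lborel. cnj (h \<eta>) * cis (- (2 * pi * (x \<bullet> \<eta>))))" for x
    unfolding inverse_fourier_def by (subst Bochner_Integration.integral_cnj [symmetric]) (simp add: cis_cnj)
  \<comment> \<open>Integrating out \<open>x\<close> replaces the damping factor by its transform, a
    Gaussian of width \<open>s\<close>, so the result is a convolution of \<open>cnj h\<close> with
    that Gaussian.\<close>
  have inner: "(LINT x|lborel. of_real (?g x) * cnj (?H x) * cis (2 * pi * (x \<bullet> \<xi>)))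
      = (LINT w|lborel. cnj (h (\<xi> - s *\<^sub>R w)) * exp (- pi * (norm w)\<^sup>2))" for \<xi>
  proof -
    let ?K = "\<lambda>\<eta>. cnj (h \<eta>) * of_real ((1 / s) ^ DIM('a) * exp (- pi * (norm (\<xi> - \<eta>))\<^sup>2 / s\<^sup>2))"
    have K: "integrable lborel ?K"
    proof (rule Bochner_Integration.integrable_bound[of _ "\<lambda>\<eta>. h \<eta> * of_real ((1 / s) ^ DIM('a))"])
      show "integrable lborel (\<lambda>\<eta>. h \<eta> * of_real ((1 / s) ^ DIM('a)))"
        using h by (rule integrable_mult_left)
      show "AE \<eta> in lborel. norm (?K \<eta>) \<le> norm (h \<eta> * of_real ((1 / s) ^ DIM('a)))"
        using s by (intro always_eventually allI) (auto simp: norm_mult norm_power norm_divide intro!: mult_left_mono divide_right_mono)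
    qed measurable
    have "(LINT x|lborel. of_real (?g x) * cnj (?H x) * cis (2 * pi * (x \<bullet> \<xi>)))
      = (LINT x|lborel. LINT \<eta>|lborel. of_real (?g x) * (cnj (h \<eta>) * cis (2 * pi * ((\<xi> - \<eta>) \<bullet> x))))"
    proof (rule Bochner_Integration.integral_cong[OF refl])
      fix x
      have "of_real (?g x) * cnj (?H x) * cis (2 * pi * (x \<bullet> \<xi>))
        = of_real (?g x) * cis (2 * pi * (x \<bullet> \<xi>)) * cnj (?H x)" by simp
      also have "\<dots> = (LINT \<eta>|lborel. of_real (?g x) * cis (2 * pi * (x \<bullet> \<xi>)) * (cnj (h \<eta>) * cis (- (2 * pi * (x \<bullet> \<eta>)))))"
        unfolding cnjH by (rule integral_mult_right_zero[symmetric])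
      also have "\<dots> = (LINT \<eta>|lborel. of_real (?g x) * (cnj (h \<eta>) * cis (2 * pi * ((\<xi> - \<eta>) \<bullet> x))))"
      proof (rule Bochner_Integration.integral_cong[OF refl])
        fix \<eta>
        have "cis (2 * pi * ((\<xi> - \<eta>) \<bullet> x)) = cis (2 * pi * (x \<bullet> \<xi>)) * cis (- (2 * pi * (x \<bullet> \<eta>)))"
          by (simp add: cis_mult inner_diff_left inner_commute algebra_simps)
        then show "of_real (?g x) * cis (2 * pi * (x \<bullet> \<xi>)) * (cnj (h \<eta>) * cis (- (2 * pi * (x \<bullet> \<eta>))))
          = of_real (?g x) * (cnj (h \<eta>) * cis (2 * pi * ((\<xi> - \<eta>) \<bullet> x)))" by simp
      qed
      finally show "of_real (?g x) * cnj (?H x) * cis (2 * pi * (x \<bullet> \<xi>)) = \<dots>" .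
    qed
    also have "\<dots> = (LINT \<eta>|lborel. LINT x|lborel. of_real (?g x) * (cnj (h \<eta>) * cis (2 * pi * ((\<xi> - \<eta>) \<bullet> x))))"
      by (rule lborel_integral_swap[OF _ g habs]) (auto simp: norm_mult)
    also have "\<dots> = (LINT \<eta>|lborel. ?K \<eta>)"
    proof (rule Bochner_Integration.integral_cong[OF refl])
      fix \<eta>
      have "(LINT x|lborel. of_real (?g x) * (cnj (h \<eta>) * cis (2 * pi * ((\<xi> - \<eta>) \<bullet> x))))
        = (LINT x|lborel. cnj (h \<eta>) * (of_real (?g x) * cis (2 * pi * ((\<xi> - \<eta>) \<bullet> x))))"
        by (simp add: mult_ac)
      then show "(LINT x|lborel. of_real (?g x) * (cnj (h \<eta>) * cis (2 * pi * ((\<xi> - \<eta>) \<bullet> x)))) = ?K \<eta>"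
        by (simp only: integral_mult_right_zero gaussian_fourier(2)[OF s])
    qed
    \<comment> \<open>The substitution \<open>\<eta> = \<xi> - s * w\<close> cancels the factor
      \<open>(1 / s) ^ DIM('a)\<close> and moves \<open>s\<close> into the argument of
      \<open>h\<close>, where continuity can act as \<open>s\<close> tends to 0.\<close>
    also have "\<dots> = s ^ DIM('a) *\<^sub>R (LINT w|lborel. ?K (\<xi> + (- s) *\<^sub>R w))"
      using s lborel_integral_affine[OF _ K, of "- s" \<xi>] by simp
    also have "\<dots> = (LINT w|lborel. of_real (s ^ DIM('a)) * ?K (\<xi> + (- s) *\<^sub>R w))"
      by (simp only: scaleR_conv_of_real integral_mult_right_zero)
    also have "\<dots> = (LINT w|lborel. cnj (h (\<xi> - s *\<^sub>R w)) * exp (- pi * (norm w)\<^sup>2))"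
      using s by (intro Bochner_Integration.integral_cong refl) (simp add: power_divide power_mult_distrib)
    finally show ?thesis .
  qed
  \<comment> \<open>Only the unconjugated factor of \<open>?H x * cnj (?H x)\<close> is unfolded.
    The other one is bounded by the L1 norm of \<open>h\<close>, which gives the product majorant
    for the swap.\<close>
  have "(LINT x|lborel. complex_of_real (?g x * (cmod (?H x))\<^sup>2))
    = (LINT x|lborel. LINT \<xi>|lborel. of_real (?g x) * cnj (?H x) * (h \<xi> * cis (2 * pi * (x \<bullet> \<xi>))))"
  proof (rule Bochner_Integration.integral_cong[OF refl])
    fix x
    have "complex_of_real (?g x * (cmod (?H x))\<^sup>2) = of_real (?g x) * (?H x * cnj (?H x))"
      by (simp only: of_real_mult complex_norm_square)
    also have "\<dots> = of_real (?g x) * cnj (?H x) * ?H x" by simp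
    also have "\<dots> = (LINT \<xi>|lborel. of_real (?g x) * cnj (?H x) * (h \<xi> * cis (2 * pi * (x \<bullet> \<xi>))))"
      by (subst (2) inverse_fourier_def) (rule integral_mult_right_zero[symmetric])
    finally show "complex_of_real (?g x * (cmod (?H x))\<^sup>2) = \<dots>" .
  qed
  also have "\<dots> = (LINT \<xi>|lborel. LINT x|lborel. of_real (?g x) * cnj (?H x) * (h \<xi> * cis (2 * pi * (x \<bullet> \<xi>))))"
  proof (rule lborel_integral_swap)
    show "integrable lborel (\<lambda>x. ?g x * (LINT \<xi>|lborel. cmod (h \<xi>)))" using g by (rule integrable_mult_left)
    show "cmod (of_real (?g x) * cnj (?H x) * (h \<xi> * cis (2 * pi * (x \<bullet> \<xi>))))
      \<le> ?g x * (LINT \<xi>|lborel. cmod (h \<xi>)) * cmod (h \<xi>)" for x \<xi>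
      using norm_inverse_fourier_le[of h x] by (auto simp: norm_mult mult.assoc intro!: mult_left_mono mult_right_mono)
  qed (use habs in measurable)
  also have "\<dots> = (LINT \<xi>|lborel. LINT x|lborel. h \<xi> * (of_real (?g x) * cnj (?H x) * cis (2 * pi * (x \<bullet> \<xi>))))"
    by (simp add: mult_ac)
  also have "\<dots> = (LINT \<xi>|lborel. h \<xi> * (LINT w|lborel. cnj (h (\<xi> - s *\<^sub>R w)) * exp (- pi * (norm w)\<^sup>2)))"
    by (simp only: integral_mult_right_zero inner)
  finally show ?thesis .
qed

text \<open>The damped identity is taken to the limit \<open>s\<close> to 0. On the frequency side
  dominated convergence applies. On the \<open>x\<close> side the Gaussian weights increase to 1, so
  monotone convergence applies before the integral of the squared transform is known to be
  finite.\<close>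

theorem plancherel:
  fixes h :: "'a::euclidean_space \<Rightarrow> complex"
  assumes h: "integrable lborel h" and cont: "continuous_on UNIV h" and B: "\<And>x. cmod (h x) \<le> B"
  shows "(\<integral>\<^sup>+x. ennreal ((cmod (inverse_fourier h x))\<^sup>2) \<partial>lborel) = (\<integral>\<^sup>+\<xi>. ennreal ((cmod (h \<xi>))\<^sup>2) \<partial>lborel)"
proof -
  let ?s = "\<lambda>m. 1 / real (Suc m)"
  let ?H = "inverse_fourier h"
  let ?g = "\<lambda>m (x::'a). exp (- pi * (?s m)\<^sup>2 * (norm x)\<^sup>2)"
  let ?e = "\<lambda>w::'a. exp (- pi * (norm w)\<^sup>2)"
  have [measurable]: "h \<in> borel_measurable borel" using h by auto
  have B0: "B \<ge> 0" using B[of 0] norm_ge_zero order_trans by blast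
  have s: "?s m > 0" for m by simp
  have s0: "?s \<longlonglongrightarrow> 0" by (rule LIMSEQ_inverse_real_of_nat[unfolded inverse_eq_divide])
  have e: "integrable lborel ?e" "integral\<^sup>L lborel ?e = 1"
    using integral_gaussian[of 1, where 'a='a] by simp_all
  have h2: "integrable lborel (\<lambda>\<xi>. (cmod (h \<xi>))\<^sup>2)"
  proof (rule Bochner_Integration.integrable_bound[of _ "\<lambda>\<xi>. B * cmod (h \<xi>)"])
    show "integrable lborel (\<lambda>\<xi>. B * cmod (h \<xi>))" using h by auto
    show "AE \<xi> in lborel. norm ((cmod (h \<xi>))\<^sup>2) \<le> norm (B * cmod (h \<xi>))"
      using B B0 by (intro always_eventually allI) (auto simp: power2_eq_square abs_mult intro!: mult_right_mono)
  qed measurable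
  define K where "K = (\<lambda>m \<xi>. LINT w|lborel. cnj (h (\<xi> - ?s m *\<^sub>R w)) * ?e w)"
  have [measurable]: "K m \<in> borel_measurable borel" for m
    unfolding K_def by measurable
  have Kint: "cmod (cnj (h (\<xi> - ?s m *\<^sub>R w)) * ?e w) \<le> B * ?e w" for m \<xi> w
    using B by (auto simp: norm_mult intro!: mult_right_mono)
  have Kbound: "cmod (K m \<xi>) \<le> B" for m \<xi>
  proof -
    have "integrable lborel (\<lambda>w. cnj (h (\<xi> - ?s m *\<^sub>R w)) * ?e w)"
    proof (rule Bochner_Integration.integrable_bound[of _ "\<lambda>w. B * ?e w"])
      show "AE w in lborel. norm (cnj (h (\<xi> - ?s m *\<^sub>R w)) * ?e w) \<le> norm (B * ?e w)"
        by (intro always_eventually allI order_trans[OF Kint]) simp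
    qed (use e in auto)
    then have "cmod (K m \<xi>) \<le> (LINT w|lborel. B * ?e w)"
      unfolding K_def
    proof (rule Bochner_Integration.integral_norm_bound_integral)
      show "norm (cnj (h (\<xi> - ?s m *\<^sub>R w)) * ?e w) \<le> B * ?e w" for w by (rule Kint)
    qed (use e in auto)
    then show ?thesis using e by simp
  qed
  \<comment> \<open>Continuity of \<open>h\<close> gives the convergence at every point, and the
    unit mass of \<open>?e\<close> identifies the limit.\<close>
  have Klim: "(\<lambda>m. K m \<xi>) \<longlonglongrightarrow> cnj (h \<xi>)" for \<xi>
  proof -
    have "(\<lambda>m. K m \<xi>) \<longlonglongrightarrow> (LINT w|lborel. cnj (h (\<xi> - 0 *\<^sub>R w)) * ?e w)"
      unfolding K_def
    proof (rule integral_dominated_convergence[where w="\<lambda>w. B * ?e w"])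
      show "AE w in lborel. (\<lambda>m. cnj (h (\<xi> - ?s m *\<^sub>R w)) * complex_of_real (?e w)) \<longlonglongrightarrow> cnj (h (\<xi> - 0 *\<^sub>R w)) * complex_of_real (?e w)"
      proof (intro always_eventually allI tendsto_intros)
        fix w
        show "(\<lambda>m. h (\<xi> - ?s m *\<^sub>R w)) \<longlonglongrightarrow> h (\<xi> - 0 *\<^sub>R w)"
          using cont by (intro continuous_on_tendsto_compose[OF cont] tendsto_intros s0) auto
      qed
      show "AE w in lborel. norm (cnj (h (\<xi> - ?s m *\<^sub>R w)) * complex_of_real (?e w)) \<le> B * ?e w" for m
        by (intro always_eventually allI Kint)
    qed (use e in auto)
    also have "(LINT w|lborel. cnj (h (\<xi> - 0 *\<^sub>R w)) * ?e w) = cnj (h \<xi>)"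
      using e by (simp add: integral_complex_of_real del: of_real_exp)
    finally show ?thesis .
  qed
  have "(\<lambda>m. LINT \<xi>|lborel. h \<xi> * K m \<xi>) \<longlonglongrightarrow> (LINT \<xi>|lborel. h \<xi> * cnj (h \<xi>))"
  proof (rule integral_dominated_convergence[where w="\<lambda>\<xi>. cmod (h \<xi>) * B"])
    show "integrable lborel (\<lambda>\<xi>. cmod (h \<xi>) * B)" using h by auto
    show "AE \<xi> in lborel. (\<lambda>m. h \<xi> * K m \<xi>) \<longlonglongrightarrow> h \<xi> * cnj (h \<xi>)"
      by (intro always_eventually allI tendsto_intros Klim)
    show "AE \<xi> in lborel. norm (h \<xi> * K m \<xi>) \<le> cmod (h \<xi>) * B" for m
      using Kbound by (intro always_eventually allI) (auto simp: norm_mult intro!: mult_left_mono)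
  qed measurable
  also have "(LINT \<xi>|lborel. h \<xi> * cnj (h \<xi>)) = of_real (LINT \<xi>|lborel. (cmod (h \<xi>))\<^sup>2)"
    by (simp only: complex_norm_square[symmetric] integral_complex_of_real)
  also have "(\<lambda>m. LINT \<xi>|lborel. h \<xi> * K m \<xi>) = (\<lambda>m. of_real (LINT x|lborel. ?g m x * (cmod (?H x))\<^sup>2))"
    unfolding K_def inverse_fourier_gaussian_norm[OF h s, symmetric] integral_complex_of_real ..
  finally have "(\<lambda>m. LINT x|lborel. ?g m x * (cmod (?H x))\<^sup>2) \<longlonglongrightarrow> (LINT \<xi>|lborel. (cmod (h \<xi>))\<^sup>2)"
    by (simp only: tendsto_of_real_iff)
  then have "(\<lambda>m. ennreal (LINT x|lborel. ?g m x * (cmod (?H x))\<^sup>2)) \<longlonglongrightarrow> ennreal (LINT \<xi>|lborel. (cmod (h \<xi>))\<^sup>2)"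
    by (rule tendsto_ennrealI)
  also have "ennreal (LINT \<xi>|lborel. (cmod (h \<xi>))\<^sup>2) = (\<integral>\<^sup>+\<xi>. ennreal ((cmod (h \<xi>))\<^sup>2) \<partial>lborel)"
    using h2 by (intro nn_integral_eq_integral[symmetric]) auto
  also have "(\<lambda>m. ennreal (LINT x|lborel. ?g m x * (cmod (?H x))\<^sup>2)) = (\<lambda>m. \<integral>\<^sup>+x. ennreal (?g m x * (cmod (?H x))\<^sup>2) \<partial>lborel)"
  proof (rule ext, rule nn_integral_eq_integral[symmetric])
    fix m
    let ?M = "LINT \<xi>|lborel. cmod (h \<xi>)"
    show "integrable lborel (\<lambda>x. ?g m x * (cmod (?H x))\<^sup>2)"
    proof (rule Bochner_Integration.integrable_bound)
      show "integrable lborel (\<lambda>x. ?g m x * ?M\<^sup>2)"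
        by (rule integrable_mult_left) (rule integral_gaussian(1)[OF s])
      show "AE x in lborel. norm (?g m x * (cmod (?H x))\<^sup>2) \<le> norm (?g m x * ?M\<^sup>2)"
        by (intro always_eventually allI)
           (auto simp: abs_mult intro!: mult_left_mono power_mono norm_inverse_fourier_le)
    qed measurable
  qed auto
  finally have 1: "(\<lambda>m. \<integral>\<^sup>+x. ennreal (?g m x * (cmod (?H x))\<^sup>2) \<partial>lborel) \<longlonglongrightarrow> (\<integral>\<^sup>+\<xi>. ennreal ((cmod (h \<xi>))\<^sup>2) \<partial>lborel)" .
  have "(\<lambda>m. \<integral>\<^sup>+x. ennreal (?g m x * (cmod (?H x))\<^sup>2) \<partial>lborel) \<longlonglongrightarrow> (\<integral>\<^sup>+x. ennreal ((cmod (?H x))\<^sup>2) \<partial>lborel)"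
  proof (rule nn_integral_LIMSEQ)
    have "?g m x \<le> ?g (Suc m) x" for m x
      by (auto intro!: mult_left_mono mult_right_mono power_mono divide_left_mono)
    then show "incseq (\<lambda>m x. ennreal (?g m x * (cmod (?H x))\<^sup>2))"
      by (intro incseq_SucI le_funI ennreal_leI mult_right_mono) auto
    fix x
    have "(\<lambda>m. ?g m x * (cmod (?H x))\<^sup>2) \<longlonglongrightarrow> exp (- pi * 0\<^sup>2 * (norm x)\<^sup>2) * (cmod (?H x))\<^sup>2"
      by (intro tendsto_intros s0)
    then show "(\<lambda>m. ennreal (?g m x * (cmod (?H x))\<^sup>2)) \<longlonglongrightarrow> ennreal ((cmod (?H x))\<^sup>2)"
      by (intro tendsto_ennrealI) simp
  qed auto
  from LIMSEQ_unique[OF this 1] show ?thesis .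
qed

section \<open>Polar coordinates\<close>

lemma nn_integral_inverse_power_tail:
  fixes a :: real
  assumes "a > 0" "n > 0"
  shows "(\<integral>\<^sup>+s. ennreal (1 / s ^ Suc n) * indicator {a..} s \<partial>lborel) = ennreal (1 / (real n * a ^ n))"
proof -
  have "(\<integral>\<^sup>+s. ennreal (1 / s ^ Suc n) * indicator {a..} s \<partial>lborel) = ennreal (0 - (- 1 / (real n * a ^ n)))"
  proof (rule nn_integral_FTC_atLeast)
    fix x :: real assume x: "a \<le> x"
    with assms have "x > 0" by simp
    have "((\<lambda>s. - inverse (real n) * inverse (s ^ n)) has_real_derivative
        - inverse (real n) * - (inverse (x ^ n) * (real n * x ^ (n - Suc 0)) * inverse (x ^ n))) (at x)"
      using \<open>x > 0\<close> by (auto intro!: derivative_eq_intros)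
    also have "- inverse (real n) * - (inverse (x ^ n) * (real n * x ^ (n - Suc 0)) * inverse (x ^ n)) = 1 / x ^ Suc n"
    proof (cases n)
      case (Suc m)
      then show ?thesis using \<open>x > 0\<close>
        by (simp add: divide_simps del: of_nat_Suc)
    qed (use assms in simp)
    finally show "((\<lambda>s. - 1 / (real n * s ^ n)) has_real_derivative 1 / x ^ Suc n) (at x)"
      by (simp add: field_simps)
  next
    have "((\<lambda>s. - inverse (real n) * inverse (s ^ n)) \<longlongrightarrow> - inverse (real n) * 0) at_top"
      using assms by (intro tendsto_intros tendsto_inverse_0_at_top filterlim_pow_at_top filterlim_ident)
    then show "((\<lambda>s. - 1 / (real n * s ^ n)) \<longlongrightarrow> 0) at_top" by (simp add: field_simps)
  qed (use assms in auto)
  then show ?thesis by simp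
qed

lemma nn_integral_sphere_measure:
  fixes g :: "'a::euclidean_space \<Rightarrow> ennreal"
  assumes [measurable]: "g \<in> borel_measurable borel"
  shows "(\<integral>\<^sup>+\<theta>. g \<theta> \<partial>sphere_measure) =
    of_nat DIM('a) * (\<integral>\<^sup>+x. g (sgn x) * indicator (ball 0 1 - {0}) x \<partial>lborel)"
proof -
  have "g \<in> borel_measurable (restrict_space borel (sphere 0 1))"
    by (rule measurable_restrict_space1) fact
  then show ?thesis unfolding sphere_measure_def
    by (simp add: nn_integral_scale_measure nn_integral_distr sgn_measurable_sphere nn_integral_restrict_space)
qed

lemma space_sphere_measure [simp]: "space (sphere_measure :: 'a::euclidean_space measure) = sphere 0 1"
  by (simp add: sphere_measure_def space_scale_measure space_restrict_space)

text \<open>The sphere measure is the cone measure, so both sides become integrals over the ball after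
  the substitution $r = s |x|$ on each ray. Swapping the integrals and substituting $w = s x$ leaves
  $\int_{|w|}^\infty s^{-n-1}\,ds = |w|^{-n} / n$.\<close>
lemma nn_integral_polar:
  fixes g :: "'a::euclidean_space \<Rightarrow> ennreal"
  assumes [measurable]: "g \<in> borel_measurable borel"
  shows "(\<integral>\<^sup>+\<theta>. (\<integral>\<^sup>+r. g (r *\<^sub>R \<theta>) * ennreal (r ^ (DIM('a) - 1)) * indicator {0<..} r \<partial>lborel) \<partial>sphere_measure)
    = (\<integral>\<^sup>+x. g x \<partial>lborel)"
proof -
  let ?n = "DIM('a)"
  have n: "?n > 0" by simp
  have sgn_meas[measurable]: "(sgn :: 'a \<Rightarrow> 'a) \<in> borel_measurable borel"
    unfolding sgn_div_norm[abs_def] by measurable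
  have [measurable]: "ball 0 1 \<in> sets (borel :: 'a measure)" "{0} \<in> sets (borel :: 'a measure)" by auto
  have radial: "(\<integral>\<^sup>+r. g (r *\<^sub>R sgn x) * ennreal (r ^ (?n - 1)) * indicator {0<..} r \<partial>lborel)
      = (\<integral>\<^sup>+s. g (s *\<^sub>R x) * ennreal (s ^ (?n - 1)) * ennreal (norm x ^ ?n) * indicator {0<..} s \<partial>lborel)"
    if "x \<noteq> 0" for x :: 'a
  proof -
    have "(\<integral>\<^sup>+r. g (r *\<^sub>R sgn x) * ennreal (r ^ (?n - 1)) * indicator {0<..} r \<partial>lborel)
      = ennreal (norm x) * (\<integral>\<^sup>+s. g ((norm x * s) *\<^sub>R sgn x) * ennreal ((norm x * s) ^ (?n - 1)) * indicator {0<..} (norm x * s) \<partial>lborel)"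
      using that by (subst nn_integral_real_affine[of _ "norm x" 0]) auto
    also have "\<dots> = (\<integral>\<^sup>+s. ennreal (norm x) * (g ((norm x * s) *\<^sub>R sgn x) * ennreal ((norm x * s) ^ (?n - 1)) * indicator {0<..} (norm x * s)) \<partial>lborel)"
      by (subst nn_integral_cmult) auto
    also have "\<dots> = (\<integral>\<^sup>+s. g (s *\<^sub>R x) * ennreal (s ^ (?n - 1)) * ennreal (norm x ^ ?n) * indicator {0<..} s \<partial>lborel)"
    proof (rule nn_integral_cong)
      fix s :: real
      have 1: "(norm x * s) *\<^sub>R sgn x = s *\<^sub>R x" using that by (simp add: sgn_div_norm)
      have 2: "norm x ^ ?n = norm x * norm x ^ (?n - 1)" using n by (cases ?n) auto
      have 3: "indicator {0<..} (norm x * s) = (indicator {0<..} s :: ennreal)"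
        using that by (auto simp: indicator_def zero_less_mult_iff)
      show "ennreal (norm x) * (g ((norm x * s) *\<^sub>R sgn x) * ennreal ((norm x * s) ^ (?n - 1)) * indicator {0<..} (norm x * s))
        = g (s *\<^sub>R x) * ennreal (s ^ (?n - 1)) * ennreal (norm x ^ ?n) * indicator {0<..} s"
        unfolding 1 2 3 by (cases "s > 0") (simp_all add: power_mult_distrib ennreal_mult mult_ac)
    qed
    finally show ?thesis .
  qed
  have "(\<integral>\<^sup>+\<theta>. (\<integral>\<^sup>+r. g (r *\<^sub>R \<theta>) * ennreal (r ^ (?n - 1)) * indicator {0<..} r \<partial>lborel) \<partial>sphere_measure)
    = of_nat ?n * (\<integral>\<^sup>+x. (\<integral>\<^sup>+r. g (r *\<^sub>R sgn x) * ennreal (r ^ (?n - 1)) * indicator {0<..} r \<partial>lborel) * indicator (ball 0 1 - {0}) x \<partial>lborel)"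
    by (subst nn_integral_sphere_measure) auto
  also have "(\<integral>\<^sup>+x. (\<integral>\<^sup>+r. g (r *\<^sub>R sgn x) * ennreal (r ^ (?n - 1)) * indicator {0<..} r \<partial>lborel) * indicator (ball 0 1 - {0}) x \<partial>lborel)
    = (\<integral>\<^sup>+x. (\<integral>\<^sup>+s. g (s *\<^sub>R x) * ennreal (s ^ (?n - 1)) * ennreal (norm x ^ ?n) * indicator {0<..} s * indicator (ball 0 1 - {0}) x \<partial>lborel) \<partial>lborel)"
  proof (rule nn_integral_cong)
    fix x :: 'a
    show "(\<integral>\<^sup>+r. g (r *\<^sub>R sgn x) * ennreal (r ^ (?n - 1)) * indicator {0<..} r \<partial>lborel) * indicator (ball 0 1 - {0}) x
      = (\<integral>\<^sup>+s. g (s *\<^sub>R x) * ennreal (s ^ (?n - 1)) * ennreal (norm x ^ ?n) * indicator {0<..} s * indicator (ball 0 1 - {0}) x \<partial>lborel)"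
      by (cases "x \<in> ball 0 1 - {0}") (use radial[of x] in \<open>simp_all add: indicator_def\<close>)
  qed
  also have "\<dots> = (\<integral>\<^sup>+s. (\<integral>\<^sup>+x. g (s *\<^sub>R x) * ennreal (s ^ (?n - 1)) * ennreal (norm x ^ ?n) * indicator {0<..} s * indicator (ball 0 1 - {0}) x \<partial>lborel) \<partial>lborel)"
    by (intro lborel_pair.Fubini') measurable
  \<comment> \<open>The condition \<open>norm x < 1\<close> becomes \<open>norm w < s\<close>,
    written as an indicator of \<open>s - norm w\<close> to be visibly measurable in both variables.
    It forces \<open>s > 0\<close>, so it also absorbs \<open>indicator {0<..} s\<close>.\<close>
  also have "\<dots> = (\<integral>\<^sup>+s. (\<integral>\<^sup>+w. g w * ennreal (norm w ^ ?n) * (ennreal (1 / s ^ Suc ?n) * indicator {0<..} (s - norm w)) * indicator (- {0}) w \<partial>lborel) \<partial>lborel)"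
  proof (rule nn_integral_cong)
    fix s :: real
    show "(\<integral>\<^sup>+x. g (s *\<^sub>R x) * ennreal (s ^ (?n - 1)) * ennreal (norm x ^ ?n) * indicator {0<..} s * indicator (ball 0 1 - {0}) x \<partial>lborel)
      = (\<integral>\<^sup>+w. g w * ennreal (norm w ^ ?n) * (ennreal (1 / s ^ Suc ?n) * indicator {0<..} (s - norm w)) * indicator (- {0}) w \<partial>lborel)"
    proof (cases "s > 0")
      case False
      then have "indicator {0<..} (s - norm w) = (0::ennreal)" for w :: 'a
        by (auto simp: indicator_def not_less intro: order_trans[OF _ norm_ge_zero])
      then show ?thesis using False by simp
    next
      case True
      have "(\<integral>\<^sup>+w. g w * ennreal (norm w ^ ?n) * (ennreal (1 / s ^ Suc ?n) * indicator {0<..} (s - norm w)) * indicator (- {0}) w \<partial>lborel)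
         = ennreal (s ^ ?n) * (\<integral>\<^sup>+x. g (s *\<^sub>R x) * ennreal (norm (s *\<^sub>R x) ^ ?n) * (ennreal (1 / s ^ Suc ?n) * indicator {0<..} (s - norm (s *\<^sub>R x))) * indicator (- {0}) (s *\<^sub>R x) \<partial>lborel)"
        using True by (subst nn_integral_lborel_affine[of _ s 0]) auto
      also have "\<dots> = (\<integral>\<^sup>+x. ennreal (s ^ ?n) * (g (s *\<^sub>R x) * ennreal (norm (s *\<^sub>R x) ^ ?n) * (ennreal (1 / s ^ Suc ?n) * indicator {0<..} (s - norm (s *\<^sub>R x))) * indicator (- {0}) (s *\<^sub>R x)) \<partial>lborel)"
        by (subst nn_integral_cmult) auto
      also have "\<dots> = (\<integral>\<^sup>+x. g (s *\<^sub>R x) * ennreal (s ^ (?n - 1)) * ennreal (norm x ^ ?n) * indicator {0<..} s * indicator (ball 0 1 - {0}) x \<partial>lborel)"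
      proof (rule nn_integral_cong)
        fix x :: 'a
        have 1: "indicator {0<..} (s - norm (s *\<^sub>R x)) * indicator (- {0}) (s *\<^sub>R x) = (indicator (ball 0 1 - {0}) x :: ennreal)"
          using True by (auto simp: indicator_def)
        have 2: "s ^ ?n * norm (s *\<^sub>R x) ^ ?n * (1 / s ^ Suc ?n) = s ^ (?n - 1) * norm x ^ ?n"
          using True n by (cases ?n) (auto simp: power_mult_distrib field_simps)
        have "ennreal (s ^ ?n) * (g (s *\<^sub>R x) * ennreal (norm (s *\<^sub>R x) ^ ?n) * (ennreal (1 / s ^ Suc ?n) * indicator {0<..} (s - norm (s *\<^sub>R x))) * indicator (- {0}) (s *\<^sub>R x))
          = g (s *\<^sub>R x) * (ennreal (s ^ ?n) * ennreal (norm (s *\<^sub>R x) ^ ?n) * ennreal (1 / s ^ Suc ?n)) * (indicator {0<..} (s - norm (s *\<^sub>R x)) * indicator (- {0}) (s *\<^sub>R x))"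
          by (simp only: mult_ac)
        also have "ennreal (s ^ ?n) * ennreal (norm (s *\<^sub>R x) ^ ?n) * ennreal (1 / s ^ Suc ?n) = ennreal (s ^ (?n - 1) * norm x ^ ?n)"
          unfolding 2[symmetric] using True by (subst ennreal_mult[symmetric]; simp)+
        finally show "ennreal (s ^ ?n) * (g (s *\<^sub>R x) * ennreal (norm (s *\<^sub>R x) ^ ?n) * (ennreal (1 / s ^ Suc ?n) * indicator {0<..} (s - norm (s *\<^sub>R x))) * indicator (- {0}) (s *\<^sub>R x))
          = g (s *\<^sub>R x) * ennreal (s ^ (?n - 1)) * ennreal (norm x ^ ?n) * indicator {0<..} s * indicator (ball 0 1 - {0}) x"
          unfolding 1 using True by (simp add: ennreal_mult mult_ac)
      qed
      finally show ?thesis ..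
    qed
  qed
  also have "\<dots> = (\<integral>\<^sup>+w. (\<integral>\<^sup>+s. g w * ennreal (norm w ^ ?n) * (ennreal (1 / s ^ Suc ?n) * indicator {0<..} (s - norm w)) * indicator (- {0}) w \<partial>lborel) \<partial>lborel)"
    by (intro lborel_pair.Fubini') measurable
  also have "\<dots> = (\<integral>\<^sup>+w. g w * ennreal (1 / real ?n) \<partial>lborel)"
  proof (rule nn_integral_cong_AE)
    have tail: "(\<integral>\<^sup>+s. g w * ennreal (norm w ^ ?n) * (ennreal (1 / s ^ Suc ?n) * indicator {0<..} (s - norm w)) * indicator (- {0}) w \<partial>lborel)
        = g w * ennreal (1 / real ?n)" if "w \<noteq> 0" for w :: 'a
    proof -
      have "(\<integral>\<^sup>+s. g w * ennreal (norm w ^ ?n) * (ennreal (1 / s ^ Suc ?n) * indicator {0<..} (s - norm w)) * indicator (- {0}) w \<partial>lborel)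
        = g w * ennreal (norm w ^ ?n) * (\<integral>\<^sup>+s. ennreal (1 / s ^ Suc ?n) * indicator {0<..} (s - norm w) \<partial>lborel)"
        using that by (subst nn_integral_cmult[symmetric]) auto
      \<comment> \<open>The open ray \<open>norm w < s\<close> and the closed ray differ only in the
        point \<open>norm w\<close>.\<close>
      also have "(\<integral>\<^sup>+s. ennreal (1 / s ^ Suc ?n) * indicator {0<..} (s - norm w) \<partial>lborel) =
         (\<integral>\<^sup>+s. ennreal (1 / s ^ Suc ?n) * indicator {norm w..} s \<partial>lborel)"
        by (intro nn_integral_cong_AE AE_I[of _ _ "{norm w}"]) (auto simp: indicator_def)
      also have "\<dots> = ennreal (1 / (real ?n * norm w ^ ?n))"
        using that by (intro nn_integral_inverse_power_tail) auto
      also have "g w * ennreal (norm w ^ ?n) * ennreal (1 / (real ?n * norm w ^ ?n)) = g w * ennreal (1 / real ?n)"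
        using that by (simp add: mult.assoc flip: ennreal_mult)
      finally show ?thesis .
    qed
    show "AE w in lborel. (\<integral>\<^sup>+s. g w * ennreal (norm w ^ ?n) * (ennreal (1 / s ^ Suc ?n) * indicator {0<..} (s - norm w)) * indicator (- {0}) w \<partial>lborel)
        = g w * ennreal (1 / real ?n)"
      using AE_lborel_singleton[of 0] by eventually_elim (rule tail)
  qed
  also have "of_nat ?n * \<dots> = (of_nat ?n * ennreal (1 / real ?n)) * (\<integral>\<^sup>+w. g w \<partial>lborel)"
    by (subst nn_integral_multc) (auto simp: mult_ac)
  \<comment> \<open>The factor \<open>DIM('a)\<close> built into \<open>sphere_measure\<close>
    cancels the \<open>1 / n\<close> left by the radial tail.\<close>
  also have "of_nat ?n * ennreal (1 / real ?n) = 1"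
    by (subst ennreal_of_nat_eq_real_of_nat, subst ennreal_mult[symmetric]) auto
  finally show ?thesis by simp
qed

section \<open>The Poisson kernel\<close>

text \<open>This is the error function up to a factor. Its limits at both ends supply the boundary
  values of the antiderivative in \<open>subordination\<close>.\<close>

lemma exists_gaussian_primitive:
  obtains \<Phi> :: "real \<Rightarrow> real" where
    "\<And>x. (\<Phi> has_real_derivative exp (- x\<^sup>2)) (at x)"
    "(\<Phi> \<longlongrightarrow> sqrt pi / 2) at_top" "(\<Phi> \<longlongrightarrow> - sqrt pi / 2) at_bot"
proof -
  obtain F where F: "\<And>x. (F has_real_derivative exp (- x\<^sup>2)) (at x)"
    using einterval_antiderivative[of "-\<infinity>" "\<infinity>" "\<lambda>x::real. exp (- x\<^sup>2)"]
    by (auto simp: has_real_derivative_iff_has_vector_derivative intro!: continuous_intros)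
  define \<Phi> where "\<Phi> = (\<lambda>x. F x - F 0)"
  have d: "(\<Phi> has_real_derivative exp (- x\<^sup>2)) (at x)" for x
    unfolding \<Phi>_def by (auto intro!: derivative_eq_intros F)
  have int: "integrable lborel (\<lambda>x::real. indicator {0..} x *\<^sub>R exp (- x\<^sup>2))"
    "(LINT x|lborel. indicator {0..} x *\<^sub>R exp (- x\<^sup>2)) = sqrt pi / 2"
    using gaussian_moment_0 by (auto simp: has_bochner_integral_iff)
  have "((\<lambda>y. LINT x|lborel. indicator {..y} x *\<^sub>R (indicator {0..} x *\<^sub>R exp (- x\<^sup>2))) \<longlongrightarrow> sqrt pi / 2) at_top"
    using tendsto_integral_at_top[OF _ int(1)] unfolding int(2) by simp
  moreover have "\<forall>\<^sub>F y in at_top. (LINT x|lborel. indicator {..y} x *\<^sub>R (indicator {0..} x *\<^sub>R exp (- x\<^sup>2))) = \<Phi> y"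
  proof (rule eventually_mono[OF eventually_ge_at_top[of 0]])
    fix y :: real assume "y \<ge> 0"
    then have "(LINT x|lborel. exp (- x\<^sup>2) * indicator {0..y} x) = \<Phi> y - \<Phi> 0"
      by (intro integral_FTC_Icc_real d continuous_intros)
    moreover have "indicator {..y} x *\<^sub>R (indicator {0..} x *\<^sub>R exp (- x\<^sup>2)) = exp (- x\<^sup>2) * indicator {0..y} x" for x
      by (auto simp: indicator_def)
    ultimately show "(LINT x|lborel. indicator {..y} x *\<^sub>R (indicator {0..} x *\<^sub>R exp (- x\<^sup>2))) = \<Phi> y"
      by (simp only: \<Phi>_def)
  qed
  ultimately have top: "(\<Phi> \<longlongrightarrow> sqrt pi / 2) at_top" by (simp cong: tendsto_cong)
  \<comment> \<open>The Gaussian is even, so its primitive vanishing at 0 is odd; this transfers the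
    limit from \<open>at_top\<close> to \<open>at_bot\<close>.\<close>
  have "((\<lambda>x. \<Phi> x + \<Phi> (- x)) has_real_derivative 0) (at x)" for x
    by (auto intro!: derivative_eq_intros DERIV_chain'[OF _ d] d)
  then have "\<Phi> x + \<Phi> (- x) = \<Phi> 0 + \<Phi> (- 0)" for x
    by (rule DERIV_isconst_all[rule_format])
  then have odd: "\<Phi> (- x) = - \<Phi> x" for x
    by (simp add: \<Phi>_def algebra_simps)
  have "((\<lambda>x. - \<Phi> x) \<longlongrightarrow> - (sqrt pi / 2)) at_top"
    by (intro tendsto_minus top)
  then have "(\<Phi> \<longlongrightarrow> - sqrt pi / 2) at_bot"
    unfolding filterlim_at_bot_mirror by (simp add: odd)
  with d top that show ?thesis by blast
qed

text \<open>An antiderivative is $e^{2b} \Phi(\sqrt u + b / \sqrt u) + e^{-2b} \Phi(\sqrt u - b / \sqrt u)$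
  with $\Phi$ a primitive of the Gaussian.\<close>
lemma subordination:
  fixes b :: real
  assumes b: "b > 0"
  shows "integrable lborel (\<lambda>u. indicator {0<..} u * (exp (- u) / sqrt u * exp (- b\<^sup>2 / u)))"
    and "(LINT u|lborel. indicator {0<..} u * (exp (- u) / sqrt u * exp (- b\<^sup>2 / u))) = sqrt pi * exp (- 2 * b)"
proof -
  obtain \<Phi> where d: "\<And>x. (\<Phi> has_real_derivative exp (- x\<^sup>2)) (at x)"
    and top: "(\<Phi> \<longlongrightarrow> sqrt pi / 2) at_top" and bot: "(\<Phi> \<longlongrightarrow> - sqrt pi / 2) at_bot"
    by (rule exists_gaussian_primitive) blast
  define F where "F = (\<lambda>u. exp (2 * b) * \<Phi> (sqrt u + b / sqrt u) + exp (- 2 * b) * \<Phi> (sqrt u - b / sqrt u))"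
  let ?f = "\<lambda>u. exp (- u) / sqrt u * exp (- b\<^sup>2 / u)"
  have dF: "(F has_real_derivative ?f u) (at u)" if u: "u > 0" for u
  proof -
    have s: "sqrt u > 0" "(sqrt u)\<^sup>2 = u" using u by auto
    \<comment> \<open>The square \<open>(sqrt u + b / sqrt u)\<^sup>2\<close> is
      \<open>u + b\<^sup>2 / u + 2 * b\<close>, so the prefactor removes the cross term;
      \<open>e2\<close> is the same with the sign of \<open>b\<close> reversed.\<close>
    have e1: "exp (2 * b) * exp (- (sqrt u + b / sqrt u)\<^sup>2) = exp (- u) * exp (- b\<^sup>2 / u)"
      unfolding exp_add[symmetric] using s by (simp add: power2_sum power_divide field_simps) (simp add: power2_eq_square)
    have e2: "exp (- 2 * b) * exp (- (sqrt u - b / sqrt u)\<^sup>2) = exp (- u) * exp (- b\<^sup>2 / u)"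
      unfolding exp_add[symmetric] using s by (simp add: power2_diff power_divide field_simps) (simp add: power2_eq_square)
    let ?q = "inverse (sqrt u) / 2"
    have ds: "(sqrt has_real_derivative ?q) (at u)" using u by (rule DERIV_real_sqrt)
    have "(F has_real_derivative exp (2 * b) * (exp (- (sqrt u + b / sqrt u)\<^sup>2) * (?q - b * ?q / u))
        + exp (- 2 * b) * (exp (- (sqrt u - b / sqrt u)\<^sup>2) * (?q + b * ?q / u))) (at u)"
      unfolding F_def
      by (intro DERIV_add DERIV_cmult DERIV_chain2[OF d]) (use u s in \<open>auto intro!: derivative_eq_intros ds simp: power2_eq_square\<close>)
    also have "exp (2 * b) * (exp (- (sqrt u + b / sqrt u)\<^sup>2) * (?q - b * ?q / u))
        + exp (- 2 * b) * (exp (- (sqrt u - b / sqrt u)\<^sup>2) * (?q + b * ?q / u))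
      = (exp (- u) * exp (- b\<^sup>2 / u)) * (?q - b * ?q / u) + (exp (- u) * exp (- b\<^sup>2 / u)) * (?q + b * ?q / u)"
      by (simp only: mult.assoc[symmetric] e1 e2)
    \<comment> \<open>The terms with \<open>b * ?q / u\<close> cancel, and \<open>2 * ?q\<close> is
      \<open>1 / sqrt u\<close>.\<close>
    also have "\<dots> = ?f u" by (simp add: field_simps)
    finally show ?thesis .
  qed
  \<comment> \<open>Near 0 the term \<open>b / sqrt u\<close> dominates and the two arguments of
    \<Phi> tend to opposite infinities, whereas in \<open>B\<close> both tend to plus infinity.
    Hence the contributions of \<open>exp (2 * b)\<close> cancel in the difference and those of
    \<open>exp (- 2 * b)\<close> add up to \<open>sqrt pi * exp (- 2 * b)\<close>.\<close>
  have A: "((F \<circ> real_of_ereal) \<longlongrightarrow> exp (2 * b) * (sqrt pi / 2) + exp (- 2 * b) * (- sqrt pi / 2)) (at_right 0)"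
    unfolding zero_ereal_def ereal_tendsto_simps F_def
  proof (intro tendsto_intros)
    have "filterlim (\<lambda>u. sqrt u + b / sqrt u) at_top (at_right 0)" using b by real_asymp
    then show "((\<lambda>u. \<Phi> (sqrt u + b / sqrt u)) \<longlongrightarrow> sqrt pi / 2) (at_right 0)"
      by (rule filterlim_compose[OF top])
    have "filterlim (\<lambda>u. sqrt u - b / sqrt u) at_bot (at_right 0)" using b by real_asymp
    then show "((\<lambda>u. \<Phi> (sqrt u - b / sqrt u)) \<longlongrightarrow> - sqrt pi / 2) (at_right 0)"
      by (rule filterlim_compose[OF bot])
  qed
  have B: "((F \<circ> real_of_ereal) \<longlongrightarrow> exp (2 * b) * (sqrt pi / 2) + exp (- 2 * b) * (sqrt pi / 2)) (at_left \<infinity>)"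
    unfolding ereal_tendsto_simps F_def
  proof (intro tendsto_intros)
    have "filterlim (\<lambda>u. sqrt u + b / sqrt u) at_top at_top" using b by real_asymp
    then show "((\<lambda>u. \<Phi> (sqrt u + b / sqrt u)) \<longlongrightarrow> sqrt pi / 2) at_top"
      by (rule filterlim_compose[OF top])
    have "filterlim (\<lambda>u. sqrt u - b / sqrt u) at_top at_top" using b by real_asymp
    then show "((\<lambda>u. \<Phi> (sqrt u - b / sqrt u)) \<longlongrightarrow> sqrt pi / 2) at_top"
      by (rule filterlim_compose[OF top])
  qed
  have e: "einterval 0 \<infinity> = {0<..}" by (auto simp: einterval_def)
  have cont: "isCont ?f u" if "u > 0" for u
    using that by (intro continuous_intros) auto
  have 1: "set_integrable lborel (einterval 0 \<infinity>) ?f"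
    by (rule interval_integral_FTC_nonneg(1)[OF _ dF cont _ A B]) auto
  have 2: "(LBINT u=0..\<infinity>. ?f u) = exp (2 * b) * (sqrt pi / 2) + exp (- 2 * b) * (sqrt pi / 2)
     - (exp (2 * b) * (sqrt pi / 2) + exp (- 2 * b) * (- sqrt pi / 2))"
    by (rule interval_integral_FTC_nonneg(2)[OF _ dF cont _ A B]) auto
  show "integrable lborel (\<lambda>u. indicator {0<..} u * ?f u)"
    using 1 by (simp add: set_integrable_def e)
  show "(LINT u|lborel. indicator {0<..} u * ?f u) = sqrt pi * exp (- 2 * b)"
    using 2 unfolding interval_lebesgue_integral_0_infty set_lebesgue_integral_def by simp
qed

text \<open>Euler's integral after \<open>u = t / c\<close>. It serves twice: for the integral over
  the Gaussian parameter that yields the Poisson kernel, and for the integration in \<open>y\<close>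
  of the final identity.\<close>

lemma integral_Gamma_scaled:
  fixes a c :: real
  assumes a: "a > 0" and c: "c > 0"
  shows "integrable lborel (\<lambda>u. indicator {0<..} u * (u powr (a - 1) * exp (- c * u)))"
    and "(LINT u|lborel. indicator {0<..} u * (u powr (a - 1) * exp (- c * u))) = Gamma a / c powr a"
proof -
  let ?f = "\<lambda>u. indicator {0<..} u * (u powr (a - 1) * exp (- c * u))"
  have "(\<integral>\<^sup>+u. ennreal (?f u) \<partial>lborel) = ennreal (1 / c) * (\<integral>\<^sup>+t. ennreal (?f (0 + (1 / c) * t)) \<partial>lborel)"
    using c by (subst nn_integral_real_affine[of _ "1 / c" 0]) auto
  \<comment> \<open>The half-lines \<open>{0<..}\<close> and \<open>{0..}\<close> give the same
    integrand, as \<open>0 powr (a - 1)\<close> is 0 by convention.\<close>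
  also have "(\<integral>\<^sup>+t. ennreal (?f (0 + (1 / c) * t)) \<partial>lborel)
     = (\<integral>\<^sup>+t. ennreal (1 / c powr (a - 1)) * (ennreal (t powr (a - 1) / exp t) * indicator {0..} t) \<partial>lborel)"
    using c by (intro nn_integral_cong)
      (auto simp: indicator_def powr_divide zero_less_divide_iff exp_minus field_simps simp flip: ennreal_mult)
  also have "\<dots> = ennreal (1 / c powr (a - 1)) * (\<integral>\<^sup>+t. ennreal (t powr (a - 1) / exp t) * indicator {0..} t \<partial>lborel)"
    by (subst nn_integral_cmult) auto
  also have "(\<integral>\<^sup>+t. ennreal (t powr (a - 1) / exp t) * indicator {0..} t \<partial>lborel) = ennreal (Gamma a)"
    by (rule nn_integral_has_integral_lebesgue'[OF _ Gamma_integral_real[OF a]]) auto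
  also have "ennreal (1 / c) * (ennreal (1 / c powr (a - 1)) * ennreal (Gamma a)) = ennreal (Gamma a / c powr a)"
    using a c by (simp add: powr_diff field_simps flip: ennreal_mult)
  finally have "has_bochner_integral lborel ?f (Gamma a / c powr a)"
    using a c by (intro has_bochner_integral_nn_integral) auto
  then show "integrable lborel ?f" "integral\<^sup>L lborel ?f = Gamma a / c powr a"
    by (auto simp: has_bochner_integral_iff)
qed

text \<open>By \<open>subordination\<close> with \<open>b = pi * y * norm \<xi>\<close>, the
  exponential is a superposition of Gaussians in \<xi> with weight
  \<open>exp (- u) / sqrt u\<close>. Transforming each Gaussian leaves a Gamma integral in
  \<open>u\<close>. The transform contributes \<open>u\<close> to the power \<open>n / 2\<close> and
  the weight a power \<open>- 1 / 2\<close>, whence the exponent \<open>a - 1\<close>.\<close>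

lemma exp_norm_fourier:
  fixes x :: "'a::euclidean_space"
  assumes y: "y > 0"
  defines "a \<equiv> (real DIM('a) + 1) / 2"
  shows "integrable lborel (\<lambda>\<xi>::'a. exp (- 2 * pi * y * norm \<xi>))"
    and "inverse_fourier (\<lambda>\<xi>. of_real (exp (- 2 * pi * y * norm \<xi>))) x
      = of_real (Gamma a / pi powr a * (y / ((norm x)\<^sup>2 + y\<^sup>2) powr a))"
proof -
  define P where "P = (\<lambda>u. indicator {0<..} u * (exp (- u) / sqrt u))"
  define G where "G = (\<lambda>(x::'a) u \<xi>. complex_of_real (P u * exp (- (pi * y * norm \<xi>)\<^sup>2 / u)) * cis (2 * pi * (x \<bullet> \<xi>)))"
  have [measurable]: "P \<in> borel_measurable borel" unfolding P_def by measurable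
  have Gm[measurable]: "(\<lambda>(u, \<xi>). G x u \<xi>) \<in> borel_measurable (borel \<Otimes>\<^sub>M borel)" for x
    unfolding G_def by measurable
  have a0: "a > 0" by (simp add: a_def)
  \<comment> \<open>\<open>?C\<close> is the part of \<open>(1 / s) ^ DIM('a)\<close> free of
    \<open>u\<close>, for the width \<open>s\<close> chosen below, and \<open>?c x * u\<close>
    collects \<open>u\<close> from the weight and \<open>pi * (norm x)\<^sup>2 / s\<^sup>2\<close>
    from the transformed Gaussian.\<close>
  let ?C = "1 / (sqrt pi * y) ^ DIM('a)"
  let ?c = "\<lambda>x::'a. 1 + (norm x)\<^sup>2 / y\<^sup>2"
  have c0: "?c x > 0" for x :: 'a using y by (intro add_pos_nonneg) auto
  have gauss: "integrable lborel (G x u) \<and>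
      (LINT \<xi>|lborel. G x u \<xi>) = of_real (?C * (indicator {0<..} u * (u powr (a - 1) * exp (- ?c x * u))))" for x u
  proof (cases "u > 0")
    case False
    then show ?thesis by (simp add: G_def P_def)
  next
    case True
    \<comment> \<open>Chosen so that \<open>pi * s\<^sup>2 * (norm \<xi>)\<^sup>2\<close> equals
      \<open>(pi * y * norm \<xi>)\<^sup>2 / u\<close>.\<close>
    define s where "s = sqrt pi * y / sqrt u"
    have s: "s > 0" "s\<^sup>2 = pi * y\<^sup>2 / u" using True y by (auto simp: s_def power_divide power_mult_distrib)
    have Geq: "G x u = (\<lambda>\<xi>. of_real (P u) * (of_real (exp (- pi * s\<^sup>2 * (norm \<xi>)\<^sup>2)) * cis (2 * pi * (x \<bullet> \<xi>))))"
      unfolding G_def s(2) by (auto simp: power_mult_distrib power2_eq_square mult_ac)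
    have pw: "sqrt u ^ DIM('a) / sqrt u = u powr (a - 1)"
      using True by (simp add: a_def powr_half_sqrt[symmetric] powr_realpow[symmetric] powr_powr powr_diff[symmetric] diff_divide_distrib add_divide_distrib)
    have "P u * ((1 / s) ^ DIM('a) * exp (- pi * (norm x)\<^sup>2 / s\<^sup>2))
      = ?C * ((sqrt u ^ DIM('a) / sqrt u) * (exp (- u) * exp (- pi * (norm x)\<^sup>2 / s\<^sup>2)))"
      using True by (simp add: P_def s_def power_divide mult_ac)
    also have "exp (- u) * exp (- pi * (norm x)\<^sup>2 / s\<^sup>2) = exp (- ?c x * u)"
      unfolding exp_add[symmetric] s(2) using y by (simp add: field_simps)
    finally have val: "P u * ((1 / s) ^ DIM('a) * exp (- pi * (norm x)\<^sup>2 / s\<^sup>2))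
      = ?C * (indicator {0<..} u * (u powr (a - 1) * exp (- ?c x * u)))"
      using True by (simp add: pw)
    show ?thesis unfolding val[symmetric] Geq integral_mult_right_zero gaussian_fourier(2)[OF s(1)]
      by (intro conjI integrable_mult_right gaussian_fourier(1) s) simp
  qed
  \<comment> \<open>The modulus of \<open>G x\<close> is \<open>G\<close> at \<open>x = 0\<close>,
    so the evaluation in \<open>gauss\<close> also yields absolute integrability.\<close>
  have normG: "complex_of_real (cmod (G x u \<xi>)) = G 0 u \<xi>" for x u \<xi>
  proof -
    have "P u \<ge> 0" by (simp add: P_def indicator_def)
    then show ?thesis by (simp add: G_def norm_mult del: of_real_mult)
  qed
  have int: "integrable (lborel \<Otimes>\<^sub>M lborel) (\<lambda>(u, \<xi>). G x u \<xi>)" for x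
  proof (rule lborel_pair.Fubini_integrable)
    have "complex_of_real (LINT \<xi>|lborel. cmod (G x u \<xi>)) = of_real (?C * (indicator {0<..} u * (u powr (a - 1) * exp (- ?c 0 * u))))" for u
      unfolding integral_complex_of_real[symmetric] normG using gauss[of 0 u] by blast
    then have "(LINT \<xi>|lborel. cmod (G x u \<xi>)) = ?C * (indicator {0<..} u * (u powr (a - 1) * exp (- ?c 0 * u)))" for u
      by (simp only: of_real_eq_iff)
    then show "integrable lborel (\<lambda>u. LINT \<xi>|lborel. norm (case (u, \<xi>) of (u, \<xi>) \<Rightarrow> G x u \<xi>))"
      using integral_Gamma_scaled(1)[OF a0 c0[of 0]] by simp
  qed (use gauss in auto)
  \<comment> \<open>\<open>subordination\<close> requires \<open>b > 0\<close>, which excludes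
    \<open>\<xi> = 0\<close>; this is a null set.\<close>
  have sub: "(LINT u|lborel. G x u \<xi>) = of_real (sqrt pi) * (of_real (exp (- 2 * pi * y * norm \<xi>)) * cis (2 * pi * (x \<bullet> \<xi>)))"
    if "\<xi> \<noteq> 0" for x \<xi>
  proof -
    have "(LINT u|lborel. P u * exp (- (pi * y * norm \<xi>)\<^sup>2 / u)) = sqrt pi * exp (- 2 * (pi * y * norm \<xi>))"
      unfolding P_def mult.assoc by (rule subordination(2)) (use that y in auto)
    then show ?thesis
      unfolding G_def by (simp add: integral_complex_of_real mult_ac del: of_real_exp of_real_mult) (simp add: mult_ac)
  qed
  have AEsub: "AE \<xi> in lborel. (LINT u|lborel. G x u \<xi>) = of_real (sqrt pi) * (of_real (exp (- 2 * pi * y * norm \<xi>)) * cis (2 * pi * (x \<bullet> \<xi>)))" for x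
    using AE_lborel_singleton[of 0] by eventually_elim (rule sub)
  have "integrable lborel (\<lambda>\<xi>. complex_of_real (sqrt pi) * (of_real (exp (- 2 * pi * y * norm \<xi>)) * cis (2 * pi * (x \<bullet> \<xi>))))" for x :: 'a
  proof (rule integrable_cong_AE_imp)
    show "integrable lborel (\<lambda>\<xi>. LINT u|lborel. G x u \<xi>)" by (rule lborel_pair.integrable_snd[OF int])
    show "AE \<xi> in lborel. (LINT u|lborel. G x u \<xi>) = of_real (sqrt pi) * (of_real (exp (- 2 * pi * y * norm \<xi>)) * cis (2 * pi * (x \<bullet> \<xi>)))"
      by (rule AEsub)
  qed measurable
  from this[of 0] have "integrable lborel (\<lambda>\<xi>::'a. complex_of_real (sqrt pi * exp (- 2 * pi * y * norm \<xi>)))"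
    unfolding of_real_mult by simp
  then have "integrable lborel (\<lambda>\<xi>::'a. sqrt pi * exp (- 2 * pi * y * norm \<xi>))"
    unfolding complex_of_real_integrable_eq .
  then show "integrable lborel (\<lambda>\<xi>::'a. exp (- 2 * pi * y * norm \<xi>))" by simp
  have "of_real (sqrt pi) * inverse_fourier (\<lambda>\<xi>. of_real (exp (- 2 * pi * y * norm \<xi>))) x
    = (LINT \<xi>|lborel. of_real (sqrt pi) * (of_real (exp (- 2 * pi * y * norm \<xi>)) * cis (2 * pi * (x \<bullet> \<xi>))))"
    unfolding inverse_fourier_def by (rule integral_mult_right_zero[symmetric])
  also have "\<dots> = (LINT \<xi>|lborel. LINT u|lborel. G x u \<xi>)"
  proof (rule integral_cong_AE)
    show "AE \<xi> in lborel. of_real (sqrt pi) * (of_real (exp (- 2 * pi * y * norm \<xi>)) * cis (2 * pi * (x \<bullet> \<xi>))) = (LINT u|lborel. G x u \<xi>)"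
      using AEsub[of x] by eventually_elim simp
  qed measurable
  also have "\<dots> = (LINT u|lborel. LINT \<xi>|lborel. G x u \<xi>)"
    by (rule lborel_pair.Fubini_integral[OF int])
  also have "\<dots> = of_real (LINT u|lborel. ?C * (indicator {0<..} u * (u powr (a - 1) * exp (- ?c x * u))))"
    unfolding integral_complex_of_real[symmetric] using gauss by simp
  also have "(LINT u|lborel. ?C * (indicator {0<..} u * (u powr (a - 1) * exp (- ?c x * u)))) = ?C * (Gamma a / ?c x powr a)"
    unfolding integral_mult_right_zero integral_Gamma_scaled(2)[OF a0 c0] ..
  also have "?C * (Gamma a / ?c x powr a) = sqrt pi * (Gamma a / pi powr a * (y / ((norm x)\<^sup>2 + y\<^sup>2) powr a))"
  proof -
    have 1: "?c x = ((norm x)\<^sup>2 + y\<^sup>2) / y\<^sup>2" using y by (simp add: field_simps)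
    have "(y\<^sup>2) powr a = (y powr 2) powr a" using y by simp
    also have "\<dots> = y powr real (Suc DIM('a))" unfolding powr_powr by (simp add: a_def add_divide_distrib add.commute)
    also have "\<dots> = y * y ^ DIM('a)" using y by (subst powr_realpow) auto
    finally have 2: "(y\<^sup>2) powr a = y * y ^ DIM('a)" .
    have "sqrt pi ^ Suc DIM('a) = (pi powr (1 / 2)) powr real (Suc DIM('a))"
      by (subst powr_realpow) (auto simp: powr_half_sqrt)
    also have "\<dots> = pi powr a" unfolding powr_powr by (simp add: a_def add_divide_distrib add.commute)
    finally have 3: "pi powr a = sqrt pi * sqrt pi ^ DIM('a)" by simp
    have "(norm x)\<^sup>2 + y\<^sup>2 > 0" using y by (intro add_nonneg_pos) auto
    then show ?thesis unfolding 1 using y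
      by (subst powr_divide) (auto simp: 2 3 power_mult_distrib field_simps)
  qed
  finally show "inverse_fourier (\<lambda>\<xi>. of_real (exp (- 2 * pi * y * norm \<xi>))) x
      = of_real (Gamma a / pi powr a * (y / ((norm x)\<^sup>2 + y\<^sup>2) powr a))"
    unfolding of_real_mult[of "sqrt pi"] by (rule mult_left_cancel[THEN iffD1, rotated]) simp
qed

section \<open>Derivatives of the Poisson extension\<close>

lemma continuous_on_inverse_fourier:
  fixes g :: "'a::euclidean_space \<Rightarrow> complex"
  assumes g: "integrable lborel g"
  shows "continuous_on UNIV (inverse_fourier g)"
  unfolding continuous_on_sequentially
proof (intro allI ballI impI)
  fix s :: "nat \<Rightarrow> 'a" and x assume "(\<forall>n. s n \<in> UNIV) \<and> s \<longlonglongrightarrow> x"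
  then have s: "s \<longlonglongrightarrow> x" by simp
  have [measurable]: "g \<in> borel_measurable borel" using g by auto
  show "(inverse_fourier g \<circ> s) \<longlonglongrightarrow> inverse_fourier g x"
    unfolding inverse_fourier_def o_def
  proof (rule integral_dominated_convergence[where w="\<lambda>\<xi>. cmod (g \<xi>)"])
    show "AE \<xi> in lborel. (\<lambda>n. g \<xi> * cis (2 * pi * (s n \<bullet> \<xi>))) \<longlonglongrightarrow> g \<xi> * cis (2 * pi * (x \<bullet> \<xi>))"
      by (intro always_eventually allI tendsto_intros s)
  qed (use g in \<open>auto simp: norm_mult\<close>)
qed

lemma poisson_kernel_conv_fourier:
  fixes x t :: "real^'n"
  assumes "y > 0"
  shows "complex_of_real (poisson_kernel y (x - t))
    = (LINT \<xi>|lborel. of_real (exp (- 2 * pi * y * norm \<xi>)) * cis (2 * pi * ((x - t) \<bullet> \<xi>)))"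
  using exp_norm_fourier(2)[OF assms, of "x - t"]
  by (simp add: poisson_kernel_def inverse_fourier_def)

text \<open>After inserting the frequency integral for the kernel and swapping, the phase splits
  into a factor in \<open>x\<close> and a factor in \<open>t\<close>; the \<open>t\<close> integral
  is the Fourier transform of \<open>g\<close>, that is, \<open>inverse_fourier g\<close> at the
  reflected point.\<close>

lemma integral_poisson_kernel:
  fixes g :: "real^'n \<Rightarrow> complex"
  assumes g: "integrable lborel g" and y: "y > 0"
  shows "(LINT t|lborel. g t * of_real (poisson_kernel y (x - t)))
    = (LINT \<xi>|lborel. of_real (exp (- 2 * pi * y * norm \<xi>)) * (inverse_fourier g (- \<xi>) * cis (2 * pi * (x \<bullet> \<xi>))))"
proof -
  have [measurable]: "g \<in> borel_measurable borel" using g by auto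
  let ?E = "\<lambda>\<xi>::real^'n. exp (- 2 * pi * y * norm \<xi>)"
  have "(LINT t|lborel. g t * of_real (poisson_kernel y (x - t)))
    = (LINT t|lborel. LINT \<xi>|lborel. g t * (of_real (?E \<xi>) * cis (2 * pi * ((x - t) \<bullet> \<xi>))))"
    unfolding poisson_kernel_conv_fourier[OF y] integral_mult_right_zero ..
  also have "\<dots> = (LINT \<xi>|lborel. LINT t|lborel. g t * (of_real (?E \<xi>) * cis (2 * pi * ((x - t) \<bullet> \<xi>))))"
  proof (rule lborel_integral_swap)
    show "integrable lborel (\<lambda>t. cmod (g t))" using g by auto
    show "integrable lborel ?E" by (rule exp_norm_fourier(1)[OF y])
  qed (auto simp: norm_mult)
  also have "\<dots> = (LINT \<xi>|lborel. LINT t|lborel. (of_real (?E \<xi>) * cis (2 * pi * (x \<bullet> \<xi>))) * (g t * cis (2 * pi * (- \<xi> \<bullet> t))))"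
  proof (intro Bochner_Integration.integral_cong refl)
    fix \<xi> t
    have "cis (2 * pi * ((x - t) \<bullet> \<xi>)) = cis (2 * pi * (x \<bullet> \<xi>)) * cis (2 * pi * (- \<xi> \<bullet> t))"
      by (simp add: cis_mult inner_diff_left inner_commute algebra_simps)
    then show "g t * (of_real (?E \<xi>) * cis (2 * pi * ((x - t) \<bullet> \<xi>)))
      = (of_real (?E \<xi>) * cis (2 * pi * (x \<bullet> \<xi>))) * (g t * cis (2 * pi * (- \<xi> \<bullet> t)))" by simp
  qed
  finally show ?thesis
    unfolding integral_mult_right_zero inverse_fourier_def by (simp add: mult_ac)
qed

text \<open>One term of the exponential series is at most the sum. The bound trades powers of the
  frequency against exponential decay: half of the decay for integrability, all of it for
  boundedness.\<close>

lemma power_le_fact_exp: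
  fixes x :: real
  assumes "x \<ge> 0"
  shows "x ^ j \<le> fact j * exp x"
proof -
  have "(\<Sum>n\<in>{j}. x ^ n /\<^sub>R fact n) \<le> exp x"
    unfolding exp_def by (rule sum_le_suminf[OF summable_exp_generic]) (use assms in auto)
  then show ?thesis by (simp add: field_simps)
qed

lemma integrable_power_exp_norm:
  assumes y: "y > 0"
  shows "integrable lborel (\<lambda>\<xi>::'a::euclidean_space. (2 * pi * norm \<xi>) ^ j * exp (- 2 * pi * y * norm \<xi>))"
proof (rule Bochner_Integration.integrable_bound)
  show "integrable lborel (\<lambda>\<xi>::'a. (2 / y) ^ j * fact j * exp (- 2 * pi * (y / 2) * norm \<xi>))"
    using y by (intro integrable_mult_right exp_norm_fourier(1)) auto
  show "AE \<xi>::'a in lborel. norm ((2 * pi * norm \<xi>) ^ j * exp (- 2 * pi * y * norm \<xi>))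
     \<le> norm ((2 / y) ^ j * fact j * exp (- 2 * pi * (y / 2) * norm \<xi>))"
  proof (intro always_eventually allI)
    fix \<xi> :: 'a
    \<comment> \<open>Scaling to \<open>pi * y * norm \<xi>\<close> makes the exponential bound
      consume exactly half of the decay rate.\<close>
    have "(2 * pi * norm \<xi>) ^ j = (2 / y) ^ j * (pi * y * norm \<xi>) ^ j"
      using y by (simp add: power_mult_distrib power_divide)
    also have "\<dots> \<le> (2 / y) ^ j * (fact j * exp (pi * y * norm \<xi>))"
      using y by (intro mult_left_mono power_le_fact_exp) auto
    finally have "(2 * pi * norm \<xi>) ^ j * exp (- 2 * pi * y * norm \<xi>)
      \<le> (2 / y) ^ j * (fact j * exp (pi * y * norm \<xi>)) * exp (- 2 * pi * y * norm \<xi>)"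
      by (rule mult_right_mono) simp
    also have "\<dots> = (2 / y) ^ j * fact j * (exp (pi * y * norm \<xi>) * exp (- 2 * pi * y * norm \<xi>))" by simp
    also have "exp (pi * y * norm \<xi>) * exp (- 2 * pi * y * norm \<xi>) = exp (- 2 * pi * (y / 2) * norm \<xi>)"
      unfolding exp_add[symmetric] by (simp add: field_simps)
    finally show "norm ((2 * pi * norm \<xi>) ^ j * exp (- 2 * pi * y * norm \<xi>))
     \<le> norm ((2 / y) ^ j * fact j * exp (- 2 * pi * (y / 2) * norm \<xi>))"
      using y by (simp add: abs_mult)
  qed
qed measurable

text \<open>Second-order Taylor expansion in \<open>h\<close>. The restriction to
  \<open>y / 2\<close> keeps a decay rate of \<open>a * (y / 2)\<close> in the remainder, so apart
  from \<open>h\<^sup>2\<close> the bound is independent of \<open>h\<close> and stays integrable in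
  the frequency.\<close>

lemma exp_taylor_bound:
  fixes a h y :: real
  assumes a: "a \<ge> 0" and h: "\<bar>h\<bar> \<le> y / 2"
  shows "\<bar>exp (- a * (y + h)) - exp (- a * y) - h * (- a * exp (- a * y))\<bar> \<le> h\<^sup>2 * (a\<^sup>2 * exp (- a * (y / 2)))"
proof -
  \<comment> \<open>After factoring out \<open>exp (- a * y)\<close>, the Lagrange remainder sits at
    a point \<open>t\<close> with modulus at most \<open>a * (y / 2)\<close>.\<close>
  obtain t where t: "\<bar>t\<bar> \<le> \<bar>- a * h\<bar>" "exp (- a * h) = (\<Sum>m<2. (- a * h) ^ m / fact m) + exp t / fact 2 * (- a * h) ^ 2"
    using Maclaurin_exp_le[of "- a * h" 2] by blast
  have "\<bar>a * h\<bar> \<le> a * (y / 2)" using a h by (simp only: abs_mult abs_of_nonneg) (rule mult_left_mono)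
  then have "exp t \<le> exp (a * (y / 2))" using t(1) by simp
  moreover have "exp t / 2 \<le> exp t" by simp
  ultimately have "exp t / 2 \<le> exp (a * (y / 2))" by (rule order_trans[rotated])
  then have "exp t / 2 * (a * h)\<^sup>2 \<le> exp (a * (y / 2)) * (a * h)\<^sup>2"
    by (rule mult_right_mono) (rule zero_le_power2)
  moreover have "exp (- a * h) - 1 + a * h = exp t / 2 * (a * h)\<^sup>2"
    unfolding t(2) by (simp add: numeral_2_eq_2 fact_2)
  ultimately have *: "\<bar>exp (- a * h) - 1 + a * h\<bar> \<le> exp (a * (y / 2)) * (a * h)\<^sup>2"
    by (simp only: abs_of_nonneg[OF mult_nonneg_nonneg[of "exp t / 2" "(a * h)\<^sup>2"]]) simp
  have "exp (- a * (y + h)) - exp (- a * y) - h * (- a * exp (- a * y)) = exp (- a * y) * (exp (- a * h) - 1 + a * h)"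
    unfolding distrib_left exp_add by (simp add: algebra_simps)
  then have "\<bar>exp (- a * (y + h)) - exp (- a * y) - h * (- a * exp (- a * y))\<bar> = exp (- a * y) * \<bar>exp (- a * h) - 1 + a * h\<bar>"
    by (simp add: abs_mult)
  also have "\<dots> \<le> exp (- a * y) * (exp (a * (y / 2)) * (a * h)\<^sup>2)"
    by (intro mult_left_mono *) simp
  also have "\<dots> = h\<^sup>2 * (a\<^sup>2 * (exp (- a * y) * exp (a * (y / 2))))"
    by (simp add: power_mult_distrib)
  also have "exp (- a * y) * exp (a * (y / 2)) = exp (- a * (y / 2))"
    unfolding exp_add[symmetric] by simp
  finally show ?thesis .
qed

text \<open>The integrand carries the factor produced by \<open>j\<close> derivatives in \<open>y\<close>.\<close>
definition laplace_moment :: "('a::euclidean_space \<Rightarrow> complex) \<Rightarrow> nat \<Rightarrow> real \<Rightarrow> complex" where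
  "laplace_moment \<phi> j y = (LINT \<xi>|lborel. of_real ((- 2 * pi * norm \<xi>) ^ j * exp (- 2 * pi * y * norm \<xi>)) * \<phi> \<xi>)"

lemma integrable_laplace_moment:
  fixes \<phi> :: "'a::euclidean_space \<Rightarrow> complex"
  assumes [measurable]: "\<phi> \<in> borel_measurable borel" and B: "\<And>\<xi>. cmod (\<phi> \<xi>) \<le> B" and y: "y > 0"
  shows "integrable lborel (\<lambda>\<xi>. of_real ((- 2 * pi * norm \<xi>) ^ j * exp (- 2 * pi * y * norm \<xi>)) * \<phi> \<xi>)"
proof (rule Bochner_Integration.integrable_bound)
  show "integrable lborel (\<lambda>\<xi>::'a. (2 * pi * norm \<xi>) ^ j * exp (- 2 * pi * y * norm \<xi>) * B)"
    by (intro integrable_mult_left integrable_power_exp_norm y)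
  have "B \<ge> 0" using B[of 0] norm_ge_zero order_trans by blast
  then show "AE \<xi> in lborel. norm (of_real ((- 2 * pi * norm \<xi>) ^ j * exp (- 2 * pi * y * norm \<xi>)) * \<phi> \<xi>)
    \<le> norm ((2 * pi * norm \<xi>) ^ j * exp (- 2 * pi * y * norm \<xi>) * B)"
    using B by (intro always_eventually allI) (auto simp: norm_mult abs_mult power_abs norm_power intro!: mult_left_mono)
qed measurable

text \<open>Integrating \<open>exp_taylor_bound\<close> with \<open>a = 2 * pi * norm \<xi>\<close>
  bounds the error of the linear approximation by a constant times \<open>h\<^sup>2\<close>, which
  vanishes after division by the modulus of \<open>h\<close>.\<close>

lemma has_vector_derivative_laplace_moment:
  fixes \<phi> :: "'a::euclidean_space \<Rightarrow> complex"
  assumes \<phi>[measurable]: "\<phi> \<in> borel_measurable borel" and B: "\<And>\<xi>. cmod (\<phi> \<xi>) \<le> B" and y: "y > 0"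
  shows "(laplace_moment \<phi> j has_vector_derivative laplace_moment \<phi> (Suc j) y) (at y)"
proof -
  let ?w = "\<lambda>j y (\<xi>::'a). (- 2 * pi * norm \<xi>) ^ j * exp (- 2 * pi * y * norm \<xi>)"
  \<comment> \<open>The exponent \<open>j + 2\<close> combines the \<open>j\<close> factors already
    present with the two from the Taylor remainder; \<open>y / 2\<close> is the decay that the
    remainder retains.\<close>
  let ?G = "\<lambda>\<xi>::'a. (2 * pi * norm \<xi>) ^ (j + 2) * exp (- 2 * pi * (y / 2) * norm \<xi>) * B"
  define C where "C = integral\<^sup>L lborel ?G"
  have B0: "B \<ge> 0" using B[of 0] norm_ge_zero order_trans by blast
  have G: "integrable lborel ?G"
    using y by (intro integrable_mult_left integrable_power_exp_norm) auto
  note int = integrable_laplace_moment[OF \<phi> B]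
  define E where "E = (\<lambda>h. norm (laplace_moment \<phi> j (y + h) - laplace_moment \<phi> j y - h *\<^sub>R laplace_moment \<phi> (Suc j) y))"
  have bound: "E h \<le> C * h\<^sup>2"
    if h: "\<bar>h\<bar> < y / 2" for h
  proof -
    have yh: "y + h > 0" using h y by linarith
    let ?R = "\<lambda>\<xi>. of_real (?w j (y + h) \<xi>) * \<phi> \<xi> - of_real (?w j y \<xi>) * \<phi> \<xi> - h *\<^sub>R (of_real (?w (Suc j) y \<xi>) * \<phi> \<xi>)"
    have R: "integrable lborel ?R"
      by (intro Bochner_Integration.integrable_diff integrable_scaleR_right int yh y)
    have "laplace_moment \<phi> j (y + h) - laplace_moment \<phi> j y - h *\<^sub>R laplace_moment \<phi> (Suc j) y = integral\<^sup>L lborel ?R"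
      unfolding laplace_moment_def integral_scaleR_right[symmetric]
      by (subst Bochner_Integration.integral_diff[symmetric], (intro int yh y)+)
         (subst Bochner_Integration.integral_diff[symmetric], (intro Bochner_Integration.integrable_diff integrable_scaleR_right int yh y)+, simp)
    moreover have "norm (integral\<^sup>L lborel ?R) \<le> (LINT \<xi>|lborel. ?G \<xi> * h\<^sup>2)"
    proof (rule Bochner_Integration.integral_norm_bound_integral[OF R])
      show "integrable lborel (\<lambda>\<xi>. ?G \<xi> * h\<^sup>2)" using G by (rule integrable_mult_left)
      fix \<xi> :: 'a
      let ?a = "2 * pi * norm \<xi>"
      have a3: "exp (- ?a * (y / 2)) = exp (- 2 * pi * (y / 2) * norm \<xi>)" by simp
      have alg: "of_real (c * p) * z - of_real (c * q) * z - h *\<^sub>R (of_real (c * b * q) * z)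
        = of_real (c * (p - q - h * (b * q))) * z" for c p q b :: real and z :: complex
        by (simp add: scaleR_conv_of_real algebra_simps)
      have a1: "- 2 * pi * t * norm \<xi> = - ?a * t" for t by simp
      have na: "\<bar>(- ?a) ^ j\<bar> = ?a ^ j" by (simp add: power_abs abs_mult)
      have a2: "- 2 * pi * norm \<xi> = - ?a" by simp
      have "?R \<xi> = of_real ((- ?a) ^ j * (exp (- ?a * (y + h)) - exp (- ?a * y) - h * (- ?a * exp (- ?a * y)))) * \<phi> \<xi>"
        unfolding a1 a2 power_Suc2 by (rule alg)
      then have "norm (?R \<xi>) = ?a ^ j * \<bar>exp (- ?a * (y + h)) - exp (- ?a * y) - h * (- ?a * exp (- ?a * y))\<bar> * cmod (\<phi> \<xi>)"
        by (simp only: norm_mult norm_of_real abs_mult na)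
      moreover have "?a ^ j * \<bar>exp (- ?a * (y + h)) - exp (- ?a * y) - h * (- ?a * exp (- ?a * y))\<bar> * cmod (\<phi> \<xi>)
        \<le> ?a ^ j * (h\<^sup>2 * (?a\<^sup>2 * exp (- ?a * (y / 2)))) * B"
        using h B0 by (intro mult_mono mult_left_mono exp_taylor_bound B) auto
      moreover have "?a ^ j * (h\<^sup>2 * (?a\<^sup>2 * exp (- ?a * (y / 2)))) * B = ?G \<xi> * h\<^sup>2"
        unfolding a3 power_add by (simp only: mult_ac)
      ultimately show "norm (?R \<xi>) \<le> ?G \<xi> * h\<^sup>2" by (simp only:)
    qed
    moreover have "(LINT \<xi>|lborel. ?G \<xi> * h\<^sup>2) = C * h\<^sup>2" unfolding C_def by (rule integral_mult_left_zero)
    ultimately show ?thesis unfolding E_def by (simp only:)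
  qed
  have quotient: "norm (E h / norm h) \<le> C * \<bar>h\<bar>" if "h \<noteq> 0" "\<bar>h\<bar> < y / 2" for h
  proof -
    have "norm (E h / norm h) = E h / \<bar>h\<bar>" by (simp add: E_def)
    also have "\<dots> \<le> C * h\<^sup>2 / \<bar>h\<bar>" by (intro divide_right_mono bound that) simp
    also have "C * h\<^sup>2 / \<bar>h\<bar> = C * \<bar>h\<bar>" using that by (simp add: power2_eq_square abs_if)
    finally show ?thesis .
  qed
  have "((\<lambda>h. C * \<bar>h\<bar>) \<longlongrightarrow> C * \<bar>0\<bar>) (at 0)" by (intro tendsto_intros)
  then have lim: "((\<lambda>h. C * \<bar>h\<bar>) \<longlongrightarrow> 0) (at 0)" by simp
  have "(\<lambda>h. E h / norm h) \<midarrow>0\<rightarrow> 0"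
  proof (rule Lim_null_comparison[OF _ lim])
    show "\<forall>\<^sub>F h in at 0. norm (E h / norm h) \<le> C * \<bar>h\<bar>"
      unfolding eventually_at using y by (intro exI[of _ "y / 2"] conjI ballI impI quotient) (auto simp: dist_real_def)
  qed
  then show ?thesis
    unfolding has_vector_derivative_def has_derivative_at E_def by (intro conjI bounded_linear_scaleR_left)
qed

text \<open>The formula is known only for \<open>y > 0\<close>, but this set is open, so each
  derivative at such a point depends only on values there and the induction goes through.\<close>

lemma nth_vector_derivative_laplace_moment:
  fixes \<phi> :: "'a::euclidean_space \<Rightarrow> complex"
  assumes \<phi>: "\<phi> \<in> borel_measurable borel" and B: "\<And>\<xi>. cmod (\<phi> \<xi>) \<le> B"
    and u: "\<And>y. y > 0 \<Longrightarrow> u y = laplace_moment \<phi> 0 y"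
  shows "y > 0 \<Longrightarrow> nth_vector_derivative k u y = laplace_moment \<phi> k y"
proof (induction k arbitrary: y)
  case 0
  then show ?case by (simp add: nth_vector_derivative_def u)
next
  case (Suc k)
  have "nth_vector_derivative (Suc k) u y = vector_derivative (nth_vector_derivative k u) (at y)"
    by (simp add: nth_vector_derivative_def)
  also have "(nth_vector_derivative k u has_vector_derivative laplace_moment \<phi> (Suc k) y) (at y)"
    by (rule has_vector_derivative_transform_within_open[OF has_vector_derivative_laplace_moment[OF \<phi> B Suc.prems], of "{0<..}"])
       (use Suc in auto)
  then have "vector_derivative (nth_vector_derivative k u) (at y) = laplace_moment \<phi> (Suc k) y"
    by (rule vector_derivative_at)
  finally show ?case .
qed

section \<open>The two sides of the identity\<close>

text \<open>The Fubini arguments run over \<open>lborel\<close>, while \<open>f\<close> is only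
  Lebesgue measurable. Both \<open>fourier f\<close> and \<open>harmonic_ext f\<close> depend on
  \<open>f\<close> only up to null sets, so a Borel representative can replace it.\<close>

lemma lebesgue_integrable_ex_lborel:
  fixes f :: "'a::euclidean_space \<Rightarrow> complex"
  assumes f: "integrable lebesgue f"
  obtains g where "integrable lborel g" "AE x in lborel. f x = g x"
proof -
  have [measurable]: "f \<in> borel_measurable lebesgue" using f by auto
  have "(\<lambda>x. Re (f x)) \<in> borel_measurable lebesgue" "(\<lambda>x. Im (f x)) \<in> borel_measurable lebesgue" by measurable
  from this[THEN completion_ex_borel_measurable_real] obtain p q
    where pq[measurable]: "p \<in> borel_measurable lborel" "q \<in> borel_measurable lborel"
      and ae: "AE x in lborel. Re (f x) = p x" "AE x in lborel. Im (f x) = q x" by blast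
  define g where "g = (\<lambda>x. complex_of_real (p x) + \<i> * complex_of_real (q x))"
  have g[measurable]: "g \<in> borel_measurable lborel" unfolding g_def by measurable
  have fg: "AE x in lborel. f x = g x"
    using ae by eventually_elim (simp add: g_def complex_eq_iff)
  have "integrable lebesgue g"
    by (rule integrable_cong_AE_imp[OF f measurable_completion[OF g] AE_completion[OF fg]])
  then have "integrable lborel g" using integrable_completion[OF g] by simp
  with fg show ?thesis by (rule that[rotated])
qed

lemma lebesgue_integral_mult_cong_AE:
  fixes f g h :: "'a::euclidean_space \<Rightarrow> complex"
  assumes "integrable lebesgue f" and g: "integrable lborel g" and fg: "AE x in lborel. f x = g x"
    and h: "h \<in> borel_measurable borel"
  shows "(LINT x|lebesgue. f x * h x) = (LINT x|lborel. g x * h x)"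
proof -
  have [measurable]: "f \<in> borel_measurable lebesgue" using assms by auto
  have gm: "g \<in> borel_measurable lborel" using g by auto
  note [measurable] = measurable_completion[OF gm]
  have [measurable]: "h \<in> borel_measurable lebesgue"
    by (rule measurable_completion) (use h in simp)
  have "(LINT x|lebesgue. f x * h x) = (LINT x|lebesgue. g x * h x)"
  proof (rule integral_cong_AE)
    show "AE x in lebesgue. f x * h x = g x * h x"
      using AE_completion[OF fg] by eventually_elim simp
  qed measurable
  also have "\<dots> = (LINT x|lborel. g x * h x)"
    by (rule integral_completion) (use gm h in measurable)
  finally show ?thesis .
qed

section \<open>The Hardy norm of \<open>F_theta\<close> as an integral along a ray\<close>

lemma ennsqrt_power2: "(ennsqrt a)\<^sup>2 = a"
  by (cases a) (auto simp: ennsqrt_def ennreal_power power2_eq_square ennreal_top_mult simp flip: ennreal_mult)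

lemma ennsqrt_mono: "a \<le> b \<Longrightarrow> ennsqrt a \<le> ennsqrt b"
  by (cases a; cases b) (auto simp: ennsqrt_def top_unique ennreal_leI)

text \<open>On the line at height \<open>y\<close>, \<open>F_theta\<close> is a one-dimensional
  inverse transform. The damped ray functions grow pointwise as \<open>y\<close> decreases, so the
  supremum is a monotone limit.\<close>

lemma H2_norm_F_theta:
  fixes f :: "real^'n \<Rightarrow> complex" and \<theta> :: "real^'n"
  assumes n: "CARD('n) \<ge> 2"
    and cont: "continuous_on UNIV (fourier f)" and B: "\<And>\<xi>. cmod (fourier f \<xi>) \<le> B"
  shows "(H2_norm (F_theta f \<theta>))\<^sup>2
    = (\<integral>\<^sup>+r. ennreal ((cmod (fourier f (r *\<^sub>R \<theta>)) * r ^ (CARD('n) - 1))\<^sup>2) * indicator {0<..} r \<partial>lborel)"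
proof -
  let ?N = "CARD('n) - 1"
  have N: "?N > 0" using n by simp
  have B0: "B \<ge> 0" using B[of 0] norm_ge_zero order_trans by blast
  \<comment> \<open>The ray is extended to negative \<open>r\<close> by 0. The exponent is positive
    because the dimension is at least 2, so the extension is continuous at 0, as
    \<open>plancherel\<close> demands; a zeroth power of \<open>max 0 r\<close> would be 1 on the
    negative side.\<close>
  define \<phi> where "\<phi> = (\<lambda>r::real. fourier f (r *\<^sub>R \<theta>) * of_real (max 0 r ^ ?N))"
  define h where "h = (\<lambda>y r. of_real (exp (- 2 * pi * y * \<bar>r\<bar>)) * \<phi> r)"
  have ray: "continuous_on UNIV (\<lambda>r::real. fourier f (r *\<^sub>R \<theta>))"
    by (rule continuous_on_compose2[OF cont]) (auto intro: continuous_intros)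
  have \<phi>_cont: "continuous_on UNIV \<phi>"
    unfolding \<phi>_def by (intro continuous_intros ray)
  have [measurable]: "\<phi> \<in> borel_measurable borel"
    by (rule borel_measurable_continuous_onI[OF \<phi>_cont])
  have h_cont: "continuous_on UNIV (h y)" for y
    unfolding h_def by (intro continuous_intros \<phi>_cont)
  have h_meas[measurable]: "h y \<in> borel_measurable borel" for y
    by (rule borel_measurable_continuous_onI[OF h_cont])
  have h_bound: "cmod (h y r) \<le> (2 * pi * norm r) ^ ?N * exp (- 2 * pi * y * norm r) * B" for y r
  proof -
    have "max 0 r ^ ?N \<le> (2 * pi * norm r) ^ ?N"
    proof (rule power_mono)
      have "1 * \<bar>r\<bar> \<le> 2 * pi * \<bar>r\<bar>" using pi_ge_two by (intro mult_right_mono) auto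
      then show "max 0 r \<le> 2 * pi * norm r" by auto
    qed simp
    then have "exp (- 2 * pi * y * norm r) * (cmod (fourier f (r *\<^sub>R \<theta>)) * max 0 r ^ ?N)
      \<le> exp (- 2 * pi * y * norm r) * (B * (2 * pi * norm r) ^ ?N)"
      using B B0 by (intro mult_left_mono mult_mono) auto
    then show ?thesis by (simp add: h_def \<phi>_def norm_mult norm_power mult_ac)
  qed
  have h_int: "integrable lborel (h y)" if "y > 0" for y
  proof (rule Bochner_Integration.integrable_bound)
    show "integrable lborel (\<lambda>r::real. (2 * pi * norm r) ^ ?N * exp (- 2 * pi * y * norm r) * B)"
      by (intro integrable_mult_left integrable_power_exp_norm that)
    show "AE r in lborel. norm (h y r) \<le> norm ((2 * pi * norm r) ^ ?N * exp (- 2 * pi * y * norm r) * B)"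
      by (intro always_eventually allI order_trans[OF h_bound]) simp
  qed measurable
  have h_bdd: "\<exists>C. \<forall>r. cmod (h y r) \<le> C" if y: "y > 0" for y
  proof (intro exI allI)
    fix r :: real
    have "(2 * pi * norm r) ^ ?N = (1 / y) ^ ?N * (2 * pi * y * norm r) ^ ?N"
      using y by (simp add: power_mult_distrib power_divide)
    also have "\<dots> \<le> (1 / y) ^ ?N * (fact ?N * exp (2 * pi * y * norm r))"
      using y by (intro mult_left_mono power_le_fact_exp) auto
    finally have "(2 * pi * norm r) ^ ?N * exp (- 2 * pi * y * norm r) * B
       \<le> (1 / y) ^ ?N * (fact ?N * exp (2 * pi * y * norm r)) * exp (- 2 * pi * y * norm r) * B"
      using B0 by (intro mult_right_mono) auto
    also have "\<dots> = (1 / y) ^ ?N * fact ?N * B * (exp (2 * pi * y * norm r) * exp (- 2 * pi * y * norm r))"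
      by simp
    also have "\<dots> = (1 / y) ^ ?N * fact ?N * B" unfolding exp_add[symmetric] by simp
    finally show "cmod (h y r) \<le> (1 / y) ^ ?N * fact ?N * B" using h_bound[of y r] by linarith
  qed
  have F: "F_theta f \<theta> (Complex x y) = inverse_fourier (h y) x" for x y
    unfolding F_theta_def inverse_fourier_def set_lebesgue_integral_def
  proof (rule Bochner_Integration.integral_cong[OF refl])
    fix r :: real
    show "indicator {0<..} r *\<^sub>R (exp (2 * \<i> * of_real pi * of_real r * Complex x y) * fourier f (r *\<^sub>R \<theta>) * of_real (r ^ ?N))
      = h y r * cis (2 * pi * (x \<bullet> r))"
    proof (cases "r > 0")
      case False
      then show ?thesis using N by (simp add: h_def \<phi>_def max_def)
    next
      case True
      have "2 * \<i> * of_real pi * of_real r * Complex x y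
        = of_real (- 2 * pi * y * \<bar>r\<bar>) + \<i> * of_real (2 * pi * (x \<bullet> r))"
        using True by (simp add: complex_eq_iff)
      then have "exp (2 * \<i> * of_real pi * of_real r * Complex x y)
        = of_real (exp (- 2 * pi * y * \<bar>r\<bar>)) * cis (2 * pi * (x \<bullet> r))"
        by (simp only: exp_add exp_of_real cis_conv_exp)
      then show ?thesis using True by (simp add: h_def \<phi>_def max_def)
    qed
  qed
  \<comment> \<open>\<open>A 0\<close> is the candidate for the squared norm. It may be infinite, so
    it is approached through positive heights instead of applying \<open>plancherel\<close> to
    \<open>h 0\<close>.\<close>
  define A where "A = (\<lambda>y. \<integral>\<^sup>+r. ennreal ((cmod (h y r))\<^sup>2) \<partial>lborel)"
  have L2: "L2_norm (\<lambda>x. F_theta f \<theta> (Complex x y)) = ennsqrt (A y)" if y: "y > 0" for y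
  proof -
    obtain C where "\<And>r. cmod (h y r) \<le> C" using h_bdd[OF y] by blast
    from plancherel[OF h_int[OF y] h_cont this] show ?thesis
      unfolding L2_norm_def F A_def by simp
  qed
  have H2: "H2_norm (F_theta f \<theta>) = (SUP y\<in>{0<..}. ennsqrt (A y))"
    unfolding H2_norm_def by (intro SUP_cong refl) (simp add: L2)
  have h_decr: "cmod (h y r) \<le> cmod (h y' r)" if "y' \<le> y" for y y' r
    using that by (auto simp: h_def norm_mult intro!: mult_right_mono)
  have "(SUP y\<in>{0<..}. ennsqrt (A y)) \<le> ennsqrt (A 0)"
    unfolding A_def by (intro SUP_least ennsqrt_mono nn_integral_mono ennreal_leI power_mono h_decr) auto
  then have "(SUP y\<in>{0<..}. ennsqrt (A y))\<^sup>2 \<le> A 0"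
    using power_mono[of _ "ennsqrt (A 0)" 2] by (metis ennsqrt_power2 zero_le)
  \<comment> \<open>Squaring is not moved through the supremum: each \<open>A (?s m)\<close> is the
    square of one of its members, and these values converge to \<open>A 0\<close>.\<close>
  moreover have "A 0 \<le> (SUP y\<in>{0<..}. ennsqrt (A y))\<^sup>2"
  proof -
    let ?s = "\<lambda>m. 1 / real (Suc m)"
    have s0: "?s \<longlonglongrightarrow> 0" by (rule LIMSEQ_inverse_real_of_nat[unfolded inverse_eq_divide])
    have "(\<lambda>m. A (?s m)) \<longlonglongrightarrow> A 0"
      unfolding A_def
    proof (rule nn_integral_LIMSEQ)
      show "incseq (\<lambda>m r. ennreal ((cmod (h (?s m) r))\<^sup>2))"
        by (intro incseq_SucI le_funI ennreal_leI power_mono h_decr) (auto intro: divide_left_mono)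
      show "(\<lambda>m. ennreal ((cmod (h (?s m) r))\<^sup>2)) \<longlonglongrightarrow> ennreal ((cmod (h 0 r))\<^sup>2)" for r
        unfolding h_def by (intro tendsto_ennrealI tendsto_intros s0)
    qed measurable
    moreover have "A (?s m) \<le> (SUP y\<in>{0<..}. ennsqrt (A y))\<^sup>2" for m
    proof -
      have "ennsqrt (A (?s m)) \<le> (SUP y\<in>{0<..}. ennsqrt (A y))" by (rule SUP_upper) simp
      then have "(ennsqrt (A (?s m)))\<^sup>2 \<le> (SUP y\<in>{0<..}. ennsqrt (A y))\<^sup>2" by (rule power_mono) simp
      then show ?thesis by (simp only: ennsqrt_power2)
    qed
    ultimately show ?thesis using LIMSEQ_le_const2 by blast
  qed
  ultimately have "(H2_norm (F_theta f \<theta>))\<^sup>2 = A 0" unfolding H2 by (rule antisym)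
  also have "A 0 = (\<integral>\<^sup>+r. ennreal ((cmod (fourier f (r *\<^sub>R \<theta>)) * r ^ ?N)\<^sup>2) * indicator {0<..} r \<partial>lborel)"
    unfolding A_def using N by (intro nn_integral_cong)
      (auto simp: h_def \<phi>_def norm_mult norm_power indicator_def max_def)
  finally show ?thesis .
qed

text \<open>Of the power \<open>r ^ (2 * (n - 1))\<close> created by squaring, one half is the polar
  Jacobian and the other half becomes the weight in \<open>norm \<xi>\<close>.\<close>

lemma nn_integral_H2_norm_sphere:
  fixes f :: "real^'n \<Rightarrow> complex"
  assumes n: "CARD('n) \<ge> 2"
    and cont: "continuous_on UNIV (fourier f)" and B: "\<And>\<xi>. cmod (fourier f \<xi>) \<le> B"
  shows "(\<integral>\<^sup>+\<theta>. (H2_norm (F_theta f \<theta>))\<^sup>2 \<partial>sphere_measure)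
    = (\<integral>\<^sup>+\<xi>. ennreal ((cmod (fourier f \<xi>))\<^sup>2 * norm \<xi> ^ (CARD('n) - 1)) \<partial>lborel)"
proof -
  let ?N = "CARD('n) - 1"
  let ?g = "\<lambda>\<xi>. ennreal ((cmod (fourier f \<xi>))\<^sup>2 * norm \<xi> ^ ?N)"
  have [measurable]: "fourier f \<in> borel_measurable borel"
    by (rule borel_measurable_continuous_onI[OF cont])
  have "(\<integral>\<^sup>+\<theta>. (H2_norm (F_theta f \<theta>))\<^sup>2 \<partial>sphere_measure)
    = (\<integral>\<^sup>+\<theta>. (\<integral>\<^sup>+r. ?g (r *\<^sub>R \<theta>) * ennreal (r ^ (DIM(real^'n) - 1)) * indicator {0<..} r \<partial>lborel) \<partial>sphere_measure)"
  proof (rule nn_integral_cong)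
    fix \<theta> :: "real^'n" assume "\<theta> \<in> space sphere_measure"
    then have "norm \<theta> = 1" by simp
    then show "(H2_norm (F_theta f \<theta>))\<^sup>2 = (\<integral>\<^sup>+r. ?g (r *\<^sub>R \<theta>) * ennreal (r ^ (DIM(real^'n) - 1)) * indicator {0<..} r \<partial>lborel)"
      unfolding H2_norm_F_theta[OF n cont B]
      by (intro nn_integral_cong)
         (auto simp: indicator_def power_mult_distrib power2_eq_square mult_ac simp flip: ennreal_mult)
  qed
  also have "\<dots> = (\<integral>\<^sup>+\<xi>. ?g \<xi> \<partial>lborel)" by (rule nn_integral_polar) measurable
  finally show ?thesis .
qed

text \<open>For fixed \<open>y\<close> the moment is the inverse transform of a weighted
  \<open>G\<close>. The weight supplies the integrability required by \<open>plancherel\<close>, and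
  its own boundedness comes from \<open>power_le_fact_exp\<close>.\<close>

lemma nn_integral_laplace_moment:
  fixes G :: "'a::euclidean_space \<Rightarrow> complex"
  assumes cont: "continuous_on UNIV G" and B: "\<And>\<xi>. cmod (G \<xi>) \<le> B" and y: "y > 0"
  shows "(\<integral>\<^sup>+x. ennreal ((cmod (laplace_moment (\<lambda>\<xi>. G \<xi> * cis (2 * pi * (x \<bullet> \<xi>))) k y))\<^sup>2) \<partial>lborel)
    = (\<integral>\<^sup>+\<xi>. ennreal ((2 * pi * norm \<xi>) ^ (2 * k) * (cmod (G \<xi>))\<^sup>2 * exp (- (4 * pi * norm \<xi>) * y)) \<partial>lborel)"
proof -
  let ?h = "\<lambda>\<xi>. of_real ((- 2 * pi * norm \<xi>) ^ k * exp (- 2 * pi * y * norm \<xi>)) * G \<xi>"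
  have [measurable]: "G \<in> borel_measurable borel" by (rule borel_measurable_continuous_onI[OF cont])
  have norm_h: "cmod (?h \<xi>) = (2 * pi * norm \<xi>) ^ k * exp (- 2 * pi * y * norm \<xi>) * cmod (G \<xi>)" for \<xi>
    by (simp add: norm_mult abs_mult power_abs norm_power)
  have "laplace_moment (\<lambda>\<xi>. G \<xi> * cis (2 * pi * (x \<bullet> \<xi>))) k y = inverse_fourier ?h x" for x
    by (simp add: laplace_moment_def inverse_fourier_def mult_ac)
  then have "(\<integral>\<^sup>+x. ennreal ((cmod (laplace_moment (\<lambda>\<xi>. G \<xi> * cis (2 * pi * (x \<bullet> \<xi>))) k y))\<^sup>2) \<partial>lborel)
    = (\<integral>\<^sup>+x. ennreal ((cmod (inverse_fourier ?h x))\<^sup>2) \<partial>lborel)" by simp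
  also have "\<dots> = (\<integral>\<^sup>+\<xi>. ennreal ((cmod (?h \<xi>))\<^sup>2) \<partial>lborel)"
  proof (rule plancherel)
    show "integrable lborel ?h" by (rule integrable_laplace_moment[OF _ B y]) measurable
    show "continuous_on UNIV ?h" by (intro continuous_intros cont)
    fix \<xi> :: 'a
    have B0: "B \<ge> 0" using B[of 0] norm_ge_zero order_trans by blast
    have "(2 * pi * norm \<xi>) ^ k = (1 / y) ^ k * (2 * pi * y * norm \<xi>) ^ k"
      using y by (simp add: power_mult_distrib power_divide)
    also have "\<dots> \<le> (1 / y) ^ k * (fact k * exp (2 * pi * y * norm \<xi>))"
      using y by (intro mult_left_mono power_le_fact_exp) auto
    finally have "(2 * pi * norm \<xi>) ^ k * exp (- 2 * pi * y * norm \<xi>) * cmod (G \<xi>)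
       \<le> (1 / y) ^ k * (fact k * exp (2 * pi * y * norm \<xi>)) * exp (- 2 * pi * y * norm \<xi>) * B"
      using B0 B y by (intro mult_mono mult_right_mono) auto
    also have "\<dots> = (1 / y) ^ k * fact k * B * (exp (2 * pi * y * norm \<xi>) * exp (- 2 * pi * y * norm \<xi>))"
      by simp
    also have "\<dots> = (1 / y) ^ k * fact k * B" unfolding exp_add[symmetric] by simp
    finally show "cmod (?h \<xi>) \<le> (1 / y) ^ k * fact k * B" unfolding norm_h .
  qed
  also have "\<dots> = (\<integral>\<^sup>+\<xi>. ennreal ((2 * pi * norm \<xi>) ^ (2 * k) * (cmod (G \<xi>))\<^sup>2 * exp (- (4 * pi * norm \<xi>) * y)) \<partial>lborel)"
  proof (intro nn_integral_cong arg_cong[where f=ennreal])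
    fix \<xi> :: 'a
    have "(exp (- 2 * pi * y * norm \<xi>))\<^sup>2 = exp (- (4 * pi * norm \<xi>) * y)"
      by (simp add: power2_eq_square flip: exp_add)
    then show "(cmod (?h \<xi>))\<^sup>2 = (2 * pi * norm \<xi>) ^ (2 * k) * (cmod (G \<xi>))\<^sup>2 * exp (- (4 * pi * norm \<xi>) * y)"
      unfolding norm_h by (simp only: power_mult_distrib power_even_eq) (simp add: mult_ac)
  qed
  finally show ?thesis .
qed

text \<open>With \<open>q = 2 * pi * r\<close> and \<open>m = 2 * k - n\<close>, the quotient
  \<open>q ^ (2 * k) / (2 * q) ^ (m + 1)\<close> is \<open>q ^ (n - 1) / 2 ^ (m + 1)\<close>.
  Rewriting \<open>q ^ (n - 1)\<close> through \<open>4 * pi * r\<close> costs another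
  \<open>2 ^ (n - 1)\<close>, and \<open>m + 1 + (n - 1) = 2 * k\<close>.\<close>

lemma radial_constant:
  fixes r :: real
  assumes "r > 0" "n \<ge> 1" "2 * k \<ge> n"
  shows "(2 * pi * r) ^ (2 * k) * (Gamma (real (2 * k - n) + 1) / (4 * pi * r) powr (real (2 * k - n) + 1))
    = (4 * pi) ^ (n - 1) * Gamma (2 * real k - real n + 1) / 2 ^ (2 * k) * r ^ (n - 1)"
proof -
  define m where "m = 2 * k - n"
  obtain n' where n': "n = Suc n'" using assms by (cases n) auto
  have k: "2 * k = m + 1 + n'" using assms n' by (simp add: m_def)
  \<comment> \<open>Here \<open>2 * k \<ge> n\<close> makes the truncated subtraction agree with the
    real one.\<close>
  have k': "2 * real k - real n + 1 = real m + 1" using assms by (simp add: m_def of_nat_diff)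
  define q where "q = 2 * pi * r"
  have q: "q > 0" "4 * pi * r = 2 * q" using assms by (auto simp: q_def)
  have "(2 * q) powr (real m + 1) = (2 * q) ^ (m + 1)"
    using q by (subst powr_realpow[symmetric]) (auto simp: add.commute)
  then have pw: "(2 * q) powr (real m + 1) = 2 ^ (m + 1) * q ^ (m + 1)" by (simp only: power_mult_distrib)
  have r: "(4 * pi) ^ n' * r ^ n' = 2 ^ n' * q ^ n'"
    unfolding power_mult_distrib[symmetric] q(2) ..
  have cancel: "P * Q * (c / (A * P)) = Q * c / A" "D * Q * c / (A * D) = Q * c / A"
    if "P > 0" "D > 0" for P Q c A D :: real using that by simp_all
  have "(4 * pi) ^ n' * Gamma (real m + 1) / 2 ^ (m + 1 + n') * r ^ n'
    = (4 * pi) ^ n' * r ^ n' * Gamma (real m + 1) / (2 ^ (m + 1) * 2 ^ n')"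
    unfolding power_add by simp
  also have "\<dots> = q ^ n' * Gamma (real m + 1) / 2 ^ (m + 1)"
    unfolding r by (rule cancel(2)[of 1]) auto
  finally have rhs: "(4 * pi) ^ n' * Gamma (real m + 1) / 2 ^ (m + 1 + n') * r ^ n' = q ^ n' * Gamma (real m + 1) / 2 ^ (m + 1)" .
  have lhs: "q ^ (m + 1) * q ^ n' * (Gamma (real m + 1) / (2 ^ (m + 1) * q ^ (m + 1))) = q ^ n' * Gamma (real m + 1) / 2 ^ (m + 1)"
    using q by (intro cancel(1)[of _ 1]) auto
  have n1: "n - 1 = n'" using n' by simp
  show ?thesis
    unfolding k' m_def[symmetric] n1 unfolding q(2) q_def[symmetric] k unfolding pw power_add[of q "m + 1" n'] rhs
    by (rule lhs)
qed

theorem mainTheorem5: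
  fixes f :: "real^'n \<Rightarrow> complex" and k :: nat
  assumes "CARD('n) \<ge> 2"
    and "k \<ge> 1"
    and "2 * k \<ge> CARD('n)"
    and "integrable lebesgue f"
  shows "(\<integral>\<^sup>+ (x, y) \<in> {(x, y). y > 0}.
            ennreal ((cmod (nth_vector_derivative k (\<lambda>t. harmonic_ext f x t) y))\<^sup>2
                     * y ^ (2 * k - CARD('n)))
          \<partial>(lborel :: ((real^'n) \<times> real) measure))
    = ennreal ((4 * pi) ^ (CARD('n) - 1) * Gamma (2 * real k - real CARD('n) + 1) / 2 ^ (2 * k))
      * (\<integral>\<^sup>+ \<theta>. (H2_norm (F_theta f \<theta>))\<^sup>2 \<partial>sphere_measure)"
proof -
  let ?m = "2 * k - CARD('n)"
  let ?C = "(4 * pi) ^ (CARD('n) - 1) * Gamma (2 * real k - real CARD('n) + 1) / 2 ^ (2 * k)"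
  obtain g where g: "integrable lborel g" and fg: "AE x in lborel. f x = g x"
    by (rule lebesgue_integrable_ex_lborel[OF assms(4)])
  note transfer = lebesgue_integral_mult_cong_AE[OF assms(4) g fg]
  let ?G = "fourier f"
  \<comment> \<open>Expressing the transform through the integrable \<open>g\<close> provides its
    continuity and boundedness.\<close>
  have G: "?G = (\<lambda>\<xi>. inverse_fourier g (- \<xi>))"
  proof
    fix \<xi>
    have "?G \<xi> = (LINT x|lebesgue. f x * cis (2 * pi * (- \<xi> \<bullet> x)))"
      unfolding fourier_def by (simp add: cis_conv_exp inner_commute mult_ac)
    then show "?G \<xi> = inverse_fourier g (- \<xi>)"
      by (simp only: inverse_fourier_def) (subst transfer; simp)
  qed
  have cont: "continuous_on UNIV ?G"
    unfolding G by (rule continuous_on_compose2[OF continuous_on_inverse_fourier[OF g]]) (auto intro: continuous_intros)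
  have [measurable]: "?G \<in> borel_measurable borel" by (rule borel_measurable_continuous_onI[OF cont])
  obtain B where B: "\<And>\<xi>. cmod (?G \<xi>) \<le> B"
    unfolding G using norm_inverse_fourier_le by blast
  define \<phi> where "\<phi> = (\<lambda>x \<xi>. ?G \<xi> * cis (2 * pi * (x \<bullet> \<xi>)))"
  have \<phi>_meas: "\<phi> x \<in> borel_measurable borel" for x unfolding \<phi>_def by measurable
  have \<phi>_bound: "cmod (\<phi> x \<xi>) \<le> B" for x \<xi> using B by (simp add: \<phi>_def norm_mult)
  have pk: "(\<lambda>t. complex_of_real (poisson_kernel y (x - t))) \<in> borel_measurable borel" for x :: "real^'n" and y
    unfolding poisson_kernel_def by measurable
  have ext: "harmonic_ext f x y = laplace_moment (\<phi> x) 0 y" if "y > 0" for x y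
  proof -
    have "harmonic_ext f x y = (LINT t|lborel. g t * of_real (poisson_kernel y (x - t)))"
      unfolding harmonic_ext_def by (rule transfer[OF pk])
    then show ?thesis
      unfolding integral_poisson_kernel[OF g that] laplace_moment_def \<phi>_def G by simp
  qed
  have deriv: "nth_vector_derivative k (\<lambda>t. harmonic_ext f x t) y = laplace_moment (\<phi> x) k y" if "y > 0" for x y
    by (rule nth_vector_derivative_laplace_moment[OF \<phi>_meas \<phi>_bound _ that]) (rule ext)
  have D_meas[measurable]: "(\<lambda>(x, y). laplace_moment (\<phi> x) k y) \<in> borel_measurable (borel \<Otimes>\<^sub>M borel)"
    unfolding laplace_moment_def \<phi>_def by measurable
  have "(\<integral>\<^sup>+ (x, y) \<in> {(x, y). y > 0}.
            ennreal ((cmod (nth_vector_derivative k (\<lambda>t. harmonic_ext f x t) y))\<^sup>2 * y ^ ?m)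
          \<partial>(lborel :: ((real^'n) \<times> real) measure))
    = (\<integral>\<^sup>+ (x, y). ennreal ((cmod (laplace_moment (\<phi> x) k y))\<^sup>2) * (ennreal (y ^ ?m) * indicator {0<..} y)
          \<partial>(lborel \<Otimes>\<^sub>M lborel))"
    unfolding lborel_prod by (intro nn_integral_cong) (auto simp: indicator_def deriv ennreal_mult)
  also have "\<dots> = (\<integral>\<^sup>+y. (\<integral>\<^sup>+x. ennreal ((cmod (laplace_moment (\<phi> x) k y))\<^sup>2) * (ennreal (y ^ ?m) * indicator {0<..} y) \<partial>lborel) \<partial>lborel)"
    by (subst lborel_pair.nn_integral_snd[symmetric]) simp_all
  \<comment> \<open>\<open>y ^ ?m\<close> is written as \<open>y powr (real ?m + 1 - 1)\<close> to
    match \<open>integral_Gamma_scaled\<close> with \<open>a = real ?m + 1\<close>; the indicator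
    restricts this to \<open>y > 0\<close>, where the two powers agree.\<close>
  also have "\<dots> = (\<integral>\<^sup>+y. (\<integral>\<^sup>+\<xi>. ennreal ((2 * pi * norm \<xi>) ^ (2 * k) * (cmod (?G \<xi>))\<^sup>2) *
      (ennreal (indicator {0<..} y * (y powr (real ?m + 1 - 1) * exp (- (4 * pi * norm \<xi>) * y)))) \<partial>lborel) \<partial>lborel)"
  proof (rule nn_integral_cong)
    fix y :: real
    show "(\<integral>\<^sup>+x. ennreal ((cmod (laplace_moment (\<phi> x) k y))\<^sup>2) * (ennreal (y ^ ?m) * indicator {0<..} y) \<partial>lborel)
      = (\<integral>\<^sup>+\<xi>. ennreal ((2 * pi * norm \<xi>) ^ (2 * k) * (cmod (?G \<xi>))\<^sup>2) *
      (ennreal (indicator {0<..} y * (y powr (real ?m + 1 - 1) * exp (- (4 * pi * norm \<xi>) * y)))) \<partial>lborel)"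
    proof (cases "y > 0")
      case False
      then show ?thesis by simp
    next
      case True
      have Dy: "(\<lambda>x. ennreal ((cmod (laplace_moment (\<phi> x) k y))\<^sup>2)) \<in> borel_measurable lborel"
        unfolding laplace_moment_def \<phi>_def by measurable
      have "(\<integral>\<^sup>+x. ennreal ((cmod (laplace_moment (\<phi> x) k y))\<^sup>2) * (ennreal (y ^ ?m) * indicator {0<..} y) \<partial>lborel)
        = (\<integral>\<^sup>+x. ennreal ((cmod (laplace_moment (\<phi> x) k y))\<^sup>2) \<partial>lborel) * ennreal (y ^ ?m)"
        using True by (simp add: nn_integral_multc[OF Dy])
      also have "\<dots> = (\<integral>\<^sup>+\<xi>. ennreal ((2 * pi * norm \<xi>) ^ (2 * k) * (cmod (?G \<xi>))\<^sup>2 * exp (- (4 * pi * norm \<xi>) * y)) * ennreal (y ^ ?m) \<partial>lborel)"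
        unfolding \<phi>_def nn_integral_laplace_moment[OF cont B True] by (rule nn_integral_multc[symmetric]) measurable
      also have "\<dots> = (\<integral>\<^sup>+\<xi>. ennreal ((2 * pi * norm \<xi>) ^ (2 * k) * (cmod (?G \<xi>))\<^sup>2) *
        (ennreal (indicator {0<..} y * (y powr (real ?m + 1 - 1) * exp (- (4 * pi * norm \<xi>) * y)))) \<partial>lborel)"
        using True by (intro nn_integral_cong) (simp add: powr_realpow mult_ac flip: ennreal_mult)
      finally show ?thesis .
    qed
  qed
  also have "\<dots> = (\<integral>\<^sup>+\<xi>. (\<integral>\<^sup>+y. ennreal ((2 * pi * norm \<xi>) ^ (2 * k) * (cmod (?G \<xi>))\<^sup>2) *
      (ennreal (indicator {0<..} y * (y powr (real ?m + 1 - 1) * exp (- (4 * pi * norm \<xi>) * y)))) \<partial>lborel) \<partial>lborel)"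
    by (intro lborel_pair.Fubini') measurable
  also have "\<dots> = (\<integral>\<^sup>+\<xi>. ennreal ?C * ennreal ((cmod (?G \<xi>))\<^sup>2 * norm \<xi> ^ (CARD('n) - 1)) \<partial>lborel)"
  proof (rule nn_integral_cong_AE)
    \<comment> \<open>The Gamma integral needs the positive rate \<open>4 * pi * norm \<xi>\<close>,
      so the origin is set aside as a null set.\<close>
    have eq: "(\<integral>\<^sup>+y. ennreal ((2 * pi * norm \<xi>) ^ (2 * k) * (cmod (?G \<xi>))\<^sup>2) *
      (ennreal (indicator {0<..} y * (y powr (real ?m + 1 - 1) * exp (- (4 * pi * norm \<xi>) * y)))) \<partial>lborel)
      = ennreal ?C * ennreal ((cmod (?G \<xi>))\<^sup>2 * norm \<xi> ^ (CARD('n) - 1))" if "\<xi> \<noteq> 0" for \<xi>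
    proof -
      have c: "4 * pi * norm \<xi> > 0" and m: "real ?m + 1 > 0" using that by auto
      let ?I = "Gamma (real ?m + 1) / (4 * pi * norm \<xi>) powr (real ?m + 1)"
      have "(\<integral>\<^sup>+y. ennreal (indicator {0<..} y * (y powr (real ?m + 1 - 1) * exp (- (4 * pi * norm \<xi>) * y))) \<partial>lborel)
        = ennreal ?I"
        unfolding integral_Gamma_scaled(2)[OF m c, symmetric]
        by (intro nn_integral_eq_integral integral_Gamma_scaled(1)[OF m c]) auto
      then have "(\<integral>\<^sup>+y. ennreal ((2 * pi * norm \<xi>) ^ (2 * k) * (cmod (?G \<xi>))\<^sup>2) *
        (ennreal (indicator {0<..} y * (y powr (real ?m + 1 - 1) * exp (- (4 * pi * norm \<xi>) * y)))) \<partial>lborel)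
        = ennreal ((2 * pi * norm \<xi>) ^ (2 * k) * (cmod (?G \<xi>))\<^sup>2) * ennreal ?I"
        by (subst nn_integral_cmult) auto
      also have "\<dots> = ennreal ((cmod (?G \<xi>))\<^sup>2 * ((2 * pi * norm \<xi>) ^ (2 * k) * ?I))"
        using m by (subst ennreal_mult[symmetric]) (auto simp: mult_ac intro!: divide_nonneg_nonneg Gamma_real_nonneg)
      also have "(2 * pi * norm \<xi>) ^ (2 * k) * ?I = ?C * norm \<xi> ^ (CARD('n) - 1)"
        using that assms by (intro radial_constant) auto
      also have "ennreal ((cmod (?G \<xi>))\<^sup>2 * (?C * norm \<xi> ^ (CARD('n) - 1))) = ennreal ?C * ennreal ((cmod (?G \<xi>))\<^sup>2 * norm \<xi> ^ (CARD('n) - 1))"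
        using assms by (subst ennreal_mult[symmetric]) (auto simp: mult_ac intro!: divide_nonneg_nonneg mult_nonneg_nonneg Gamma_real_nonneg)
      finally show ?thesis .
    qed
    show "AE \<xi> in lborel. (\<integral>\<^sup>+y. ennreal ((2 * pi * norm \<xi>) ^ (2 * k) * (cmod (?G \<xi>))\<^sup>2) *
      (ennreal (indicator {0<..} y * (y powr (real ?m + 1 - 1) * exp (- (4 * pi * norm \<xi>) * y)))) \<partial>lborel)
      = ennreal ?C * ennreal ((cmod (?G \<xi>))\<^sup>2 * norm \<xi> ^ (CARD('n) - 1))"
      using AE_lborel_singleton[of 0] by eventually_elim (rule eq)
  qed
  also have "\<dots> = ennreal ?C * (\<integral>\<^sup>+\<xi>. ennreal ((cmod (?G \<xi>))\<^sup>2 * norm \<xi> ^ (CARD('n) - 1)) \<partial>lborel)"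
    by (rule nn_integral_cmult) measurable
  also have "(\<integral>\<^sup>+\<xi>. ennreal ((cmod (?G \<xi>))\<^sup>2 * norm \<xi> ^ (CARD('n) - 1)) \<partial>lborel)
    = (\<integral>\<^sup>+ \<theta>. (H2_norm (F_theta f \<theta>))\<^sup>2 \<partial>sphere_measure)"
    by (rule nn_integral_H2_norm_sphere[OF assms(1) cont B, symmetric])
  finally show ?thesis .
qed

end
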